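(* Let $\mathbb{S}^1\subset\mathbb{R}^2$ be the unit circle, with the distance function inherited from the Euclidean metric on $\mathbb{R}^2$. Then for every $t\in(0,\infty)$ the alpha magnitude of $t\mathbb{S}^1$ exists and $$|t\mathbb{S}^1|_\alpha=\pi t+e^{-t}.$$
   Context: Conventions: homology is ordinary (unreduced) simplicial homology with coefficients in a fixed field. For a metric space $(X,d)$ and $t>0$, $tX$ is the same set with metric $t\,d$; for $X\subset\mathbb{R}^n$ this is identified with the scaled subset $\{tx: x\in X\}\subset\mathbb{R}^n$. Alpha complex: for a finite set $X\subset\mathbb{R}^n$ and $\epsilon\ge 0$, $\alpha(X)_\epsilon$ is the nerve of the collection $\{U_x\}_{x\in X}$, where $U_x=B_\epsilon(x)\cap V_x$, $B_\epsilon(x)$ is the closed ball of radius $\epsilon$ centered at $x$, and $V_x=\{p\in\mathbb{R}^n: d(p,x)\le d(p,x')\ \forall x'\in X\}$ is the Voronoi cell of $x$. (The nerve has vertex set $X$, and a nonempty subset $\sigma\subseteq X$ is a simplex iff $\bigcap_{x\in\sigma}U_x\ne\emptyset$.) These complexes form a filtration in $\epsilon$. Persistent magnitude: if a filtered simplicial complex has, for each degree $k$, persistent homology with finite barcode $\{[a_{k,i},b_{k,i})\}_{i=1}^{m_k}$ (with $b_{k,i}\in(0,\infty]$), its persistent magnitude is $\sum_{k\ge 0}\sum_{i=1}^{m_k}(-1)^k(e^{-a_{k,i}}-e^{-b_{k,i}})$, with $e^{-\infty}=0$. Alpha magnitude of a finite set: for finite $X\subset\mathbb{R}^n$, $|X|_\alpha$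 is the persistent magnitude of the persistent homology of $\{\alpha(X)_\epsilon\}_{\epsilon\ge0}$. Alpha magnitude of a compact set: for compact $X\subset\mathbb{R}^n$, the alpha magnitude of $X$ exists and equals $L\in\mathbb{R}$, written $|X|_\alpha=L$, if for every sequence $(A_m)$ of finite subsets of $X$ converging to $X$ in the Hausdorff metric one has $\lim_{m\to\infty}|A_m|_\alpha=L$. *)

theory Defs
  imports "HOL-Analysis.Analysis" "HOL-Library.Poly_Mapping"
begin

section \<open>Simplicial homology with field coefficients\<close>

text \<open>
  A simplicial complex is given by its set of (nonempty, finite) simplices, each simplex
  being its set of vertices. Chains are finitely supported functions on simplices. To orient
  the simplices, an arbitrary linear order on the vertices is fixed once and for all; homology
  and the maps induced by inclusions do not depend on it up to natural isomorphism.
\<close>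

definition vertex_order :: "'a rel" where
  "vertex_order = (SOME r. linear_order_on UNIV r)"

lemma linear_order_vertex_order: "linear_order_on UNIV vertex_order"
proof -
  have "\<exists>r :: 'a rel. linear_order_on UNIV r"
    using well_order_on[of UNIV] by (auto simp: well_order_on_def)
  then show ?thesis
    unfolding vertex_order_def by (rule someI_ex)
qed

definition vertex_index :: "'a set \<Rightarrow> 'a \<Rightarrow> nat" where
  "vertex_index \<sigma> v = card {u \<in> \<sigma>. u \<noteq> v \<and> (u, v) \<in> vertex_order}"

definition simplices :: "nat \<Rightarrow> 'a set set \<Rightarrow> 'a set set" where
  "simplices k K = {\<sigma> \<in> K. card \<sigma> = Suc k}"

definition chains :: "nat \<Rightarrow> 'a set set \<Rightarrow> ('a set \<Rightarrow>\<^sub>0 'k::field) set" where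
  "chains k K = {c. Poly_Mapping.keys c \<subseteq> simplices k K}"

definition chain_scale :: "'k::field \<Rightarrow> ('a set \<Rightarrow>\<^sub>0 'k) \<Rightarrow> ('a set \<Rightarrow>\<^sub>0 'k)" where
  "chain_scale r c = Poly_Mapping.map (\<lambda>a. r * a) c"

text \<open>
  The linear extension of $\partial [v_0,\dots,v_k] = \sum_i (-1)^i [v_0,\dots,\hat{v_i},\dots,v_k]$
  for $v_0 < \dots < v_k$. Vertices are sent to 0 (the empty set is not a simplex), so homology
  is unreduced.
\<close>

definition chain_boundary :: "('a set \<Rightarrow>\<^sub>0 'k::field) \<Rightarrow> ('a set \<Rightarrow>\<^sub>0 'k)" where
  "chain_boundary c =
     (\<Sum>\<sigma>\<in>Poly_Mapping.keys c. \<Sum>v\<in>{v \<in> \<sigma>. \<sigma> \<noteq> {v}}.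
        Poly_Mapping.single (\<sigma> - {v}) ((-1) ^ vertex_index \<sigma> v * Poly_Mapping.lookup c \<sigma>))"

definition cycles :: "nat \<Rightarrow> 'a set set \<Rightarrow> ('a set \<Rightarrow>\<^sub>0 'k::field) set" where
  "cycles k K = {c \<in> chains k K. chain_boundary c = 0}"

definition boundaries :: "nat \<Rightarrow> 'a set set \<Rightarrow> ('a set \<Rightarrow>\<^sub>0 'k::field) set" where
  "boundaries k K = chain_boundary ` chains (Suc k) K"

record ('k, 'v) vspace =
  vcarrier :: "'v set"
  vadd :: "'v \<Rightarrow> 'v \<Rightarrow> 'v"
  vscale :: "'k \<Rightarrow> 'v \<Rightarrow> 'v"

definition homology_class :: "nat \<Rightarrow> 'a set set \<Rightarrow> ('a set \<Rightarrow>\<^sub>0 'k::field) \<Rightarrow> ('a set \<Rightarrow>\<^sub>0 'k) set" where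
  "homology_class k K z = {z + b |b. b \<in> boundaries k K}"

text \<open>
  The quotient of cycles by boundaries, with cosets as elements. In \<open>vscale\<close> the boundaries are
  added because the pointwise multiple of a coset by the scalar 0 is not a coset.
\<close>

definition homology :: "nat \<Rightarrow> 'a set set \<Rightarrow> ('k::field, ('a set \<Rightarrow>\<^sub>0 'k) set) vspace" where
  "homology k K =
     \<lparr>vcarrier = homology_class k K ` cycles k K,
      vadd = (\<lambda>A B. {x + y |x y. x \<in> A \<and> y \<in> B}),
      vscale = (\<lambda>r A. {chain_scale r x + b |x b. x \<in> A \<and> b \<in> boundaries k K})\<rparr>"

text \<open>The map $z + B_k(K) \mapsto z + B_k(L)$ induced by an inclusion $K \subseteq L$.\<close>

definition homology_inclusion ::
    "nat \<Rightarrow> 'a set set \<Rightarrow> ('a set \<Rightarrow>\<^sub>0 'k::field) set \<Rightarrow> ('a set \<Rightarrow>\<^sub>0 'k) set" where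
  "homology_inclusion k L A = (\<Union>z\<in>A. homology_class k L z)"


section \<open>Persistence modules and barcodes\<close>

text \<open>Persistence modules are indexed by $[0,\infty)$; values at negative indices are ignored.\<close>

record ('k, 'v) pmodule =
  pspace :: "real \<Rightarrow> ('k, 'v) vspace"
  pmap :: "real \<Rightarrow> real \<Rightarrow> 'v \<Rightarrow> 'v"

definition vspace_iso :: "('k, 'v) vspace \<Rightarrow> ('k, 'w) vspace \<Rightarrow> ('v \<Rightarrow> 'w) \<Rightarrow> bool" where
  "vspace_iso V W f \<longleftrightarrow>
     bij_betw f (vcarrier V) (vcarrier W) \<and>
     (\<forall>x\<in>vcarrier V. \<forall>y\<in>vcarrier V. f (vadd V x y) = vadd W (f x) (f y)) \<and>
     (\<forall>r. \<forall>x\<in>vcarrier V. f (vscale V r x) = vscale W r (f x))"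

definition pmodule_isomorphic :: "('k, 'v) pmodule \<Rightarrow> ('k, 'w) pmodule \<Rightarrow> bool" where
  "pmodule_isomorphic P Q \<longleftrightarrow>
     (\<exists>\<Phi>. (\<forall>\<epsilon>\<ge>0. vspace_iso (pspace P \<epsilon>) (pspace Q \<epsilon>) (\<Phi> \<epsilon>)) \<and>
          (\<forall>\<epsilon> \<delta>. 0 \<le> \<epsilon> \<and> \<epsilon> \<le> \<delta> \<longrightarrow>
             (\<forall>x\<in>vcarrier (pspace P \<epsilon>). \<Phi> \<delta> (pmap P \<epsilon> \<delta> x) = pmap Q \<epsilon> \<delta> (\<Phi> \<epsilon> x))))"

definition persistent_homology ::
    "nat \<Rightarrow> (real \<Rightarrow> 'a set set) \<Rightarrow> ('k::field, ('a set \<Rightarrow>\<^sub>0 'k) set) pmodule" where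
  "persistent_homology k K =
     \<lparr>pspace = (\<lambda>\<epsilon>. homology k (K \<epsilon>)), pmap = (\<lambda>\<epsilon> \<delta>. homology_inclusion k (K \<delta>))\<rparr>"

text \<open>The pair \<open>(a, b)\<close> stands for the bar $[a,b)$, where \<open>b\<close> may be \<open>\<infinity>\<close>.\<close>

type_synonym bar = "real \<times> ereal"

definition in_bar :: "real \<Rightarrow> bar \<Rightarrow> bool" where
  "in_bar \<epsilon> I \<longleftrightarrow> fst I \<le> \<epsilon> \<and> ereal \<epsilon> < snd I"

text \<open>
  The direct sum of the interval modules of a finite list of bars. At \<open>\<epsilon>\<close> it has one coordinate
  for each bar containing \<open>\<epsilon>\<close>, and the map from \<open>\<epsilon>\<close> to \<open>\<delta>\<close> forgets the coordinates of the bars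
  that do not contain \<open>\<delta>\<close>.
\<close>

definition interval_sum :: "bar list \<Rightarrow> ('k::field, nat \<Rightarrow> 'k) pmodule" where
  "interval_sum bs =
     \<lparr>pspace = (\<lambda>\<epsilon>.
        \<lparr>vcarrier = {x. \<forall>i. x i \<noteq> 0 \<longrightarrow> i < length bs \<and> in_bar \<epsilon> (bs ! i)},
         vadd = (\<lambda>x y i. x i + y i),
         vscale = (\<lambda>r x i. r * x i)\<rparr>),
      pmap = (\<lambda>\<epsilon> \<delta> x i. if i < length bs \<and> in_bar \<delta> (bs ! i) then x i else 0)\<rparr>"

definition has_barcode :: "('k::field, 'v) pmodule \<Rightarrow> bar list \<Rightarrow> bool" where
  "has_barcode P bs \<longleftrightarrow>
     (\<forall>(a, b)\<in>set bs. 0 \<le> a \<and> ereal a < b) \<and> pmodule_isomorphic P (interval_sum bs)"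


section \<open>Persistent magnitude\<close>

definition bar_magnitude :: "bar \<Rightarrow> real" where
  "bar_magnitude I =
     exp (- fst I) - (if snd I = \<infinity> then 0 else exp (- real_of_ereal (snd I)))"

definition has_persistent_magnitude ::
    "'k::field itself \<Rightarrow> (real \<Rightarrow> 'a set set) \<Rightarrow> real \<Rightarrow> bool" where
  "has_persistent_magnitude F K M \<longleftrightarrow>
     (\<exists>bs :: nat \<Rightarrow> bar list.
        (\<forall>k. has_barcode
               (persistent_homology k K :: ('k, ('a set \<Rightarrow>\<^sub>0 'k) set) pmodule) (bs k)) \<and>
        (\<lambda>k. (-1) ^ k * (\<Sum>I\<leftarrow>bs k. bar_magnitude I)) sums M)"

text \<open>
  The value is unique when it exists, since barcodes are unique up to reordering.
\<close>

definition persistent_magnitude :: "'k::field itself \<Rightarrow> (real \<Rightarrow> 'a set set) \<Rightarrow> real" where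
  "persistent_magnitude F K = (THE M. has_persistent_magnitude F K M)"


section \<open>Alpha magnitude\<close>

definition nerve :: "'i set \<Rightarrow> ('i \<Rightarrow> 'b set) \<Rightarrow> 'i set set" where
  "nerve I U = {\<sigma>. \<sigma> \<subseteq> I \<and> finite \<sigma> \<and> \<sigma> \<noteq> {} \<and> (\<Inter>x\<in>\<sigma>. U x) \<noteq> {}}"

definition voronoi_cell :: "'a::euclidean_space set \<Rightarrow> 'a \<Rightarrow> 'a set" where
  "voronoi_cell X x = {p. \<forall>x'\<in>X. dist p x \<le> dist p x'}"

definition alpha_complex :: "'a::euclidean_space set \<Rightarrow> real \<Rightarrow> 'a set set" where
  "alpha_complex X \<epsilon> = nerve X (\<lambda>x. cball x \<epsilon> \<inter> voronoi_cell X x)"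

definition alpha_magnitude :: "'k::field itself \<Rightarrow> 'a::euclidean_space set \<Rightarrow> real" where
  "alpha_magnitude F X = persistent_magnitude F (alpha_complex X)"

text \<open>
  Taking values in \<open>ennreal\<close>, where the infimum over the empty set is \<open>\<infinity>\<close>, puts the empty set
  at infinite distance from every nonempty set.
\<close>

definition hausdorff_distance :: "'a::metric_space set \<Rightarrow> 'a set \<Rightarrow> ennreal" where
  "hausdorff_distance A B =
     max (SUP a\<in>A. INF b\<in>B. ennreal (dist a b)) (SUP b\<in>B. INF a\<in>A. ennreal (dist a b))"

definition has_alpha_magnitude ::
    "'k::field itself \<Rightarrow> 'a::euclidean_space set \<Rightarrow> real \<Rightarrow> bool" where
  "has_alpha_magnitude F X L \<longleftrightarrow>
     compact X \<and>
     (\<forall>A :: nat \<Rightarrow> 'a set.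
        (\<forall>m. finite (A m) \<and> A m \<subseteq> X) \<and>
        (\<lambda>m. hausdorff_distance (A m) X) \<longlonglongrightarrow> 0 \<longrightarrow>
        (\<lambda>m. alpha_magnitude F (A m)) \<longlonglongrightarrow> L)"

end

theory Submission
  imports Defs "HOL-Library.Function_Algebras"
begin

text \<open>
  List a finite set of points of the circle of radius \<open>t\<close> in cyclic order, with angular gaps
  \<open>g\<^sub>0, \<dots>, g\<^sub>n\<^sub>-\<^sub>1\<close> all smaller than \<open>\<pi>\<close>. The Voronoi cells are planar sectors, and a point other
  than the centre lies in at most two of them, so that below scale \<open>t\<close> the alpha complex is the
  subgraph of the \<open>n\<close>-cycle whose edges have half length \<open>h\<^sub>j = t sin (g\<^sub>j / 2)\<close> at most the scale.
  From scale \<open>t\<close> on, all cells contain the centre and the complex is a full simplex. Each edge but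
  the longest kills a component at \<open>h\<^sub>j\<close>, and the longest one creates a loop that dies at \<open>t\<close>, so the
  alpha magnitude is \<open>(\<Sum>j. 1 - exp (- h\<^sub>j)) + exp (- t)\<close>. Up to second order in the gaps the
  summands are \<open>t g\<^sub>j / 2\<close>, and the gaps add up to \<open>2 \<pi>\<close>.
\<close>

section \<open>Chains, cycles and boundaries\<close>

text \<open>\<open>persistent_magnitude\<close> is a definite description, so exhibiting a barcode
  is not enough: any two barcodes of one module must have the same total magnitude. Counting
  dimensions scale by scale settles this. Listing the points with the longest gap last makes the
  edge that closes the cycle appear no earlier than any other. The remaining \<open>n - 1\<close>
  edges form a path, so each of them merges two components in whatever order they appear, and bars
  can be attached to edges without sorting the births. Gaps below \<open>pi\<close> are what
  Hausdorff convergence provides. Across a larger gap the midpoint of the chord lies beyond the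
  centre, where other points may be nearer, and the half chord need no longer be the birth of the
  edge. Gaps below \<open>pi\<close> also force at least three points, so that the graph is a
  genuine cycle. The linear terms sum to \<open>pi * t\<close> exactly, for any set of points; only
  the quadratic errors depend on the set, and the largest gap controls their sum whatever the number
  of points.\<close>

lemma lookup_chain_scale [simp]:
  "Poly_Mapping.lookup (chain_scale r c) \<sigma> = r * Poly_Mapping.lookup c \<sigma>"
  by (auto simp: chain_scale_def map.rep_eq when_def)

lemma chain_scale_add_right: "chain_scale r (x + y) = chain_scale r x + chain_scale r y"
  by (rule poly_mapping_eqI) (simp add: lookup_add algebra_simps)

lemma chain_scale_minus_one: "chain_scale (- 1) x = - x"
  by (rule poly_mapping_eqI) simp

lemma keys_chain_scale: "Poly_Mapping.keys (chain_scale r c) \<subseteq> Poly_Mapping.keys c"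
  by (auto simp: in_keys_iff)

text \<open>The definition sums over the support, which changes under addition and scaling; a common
  finite superset allows termwise comparison.\<close>

lemma chain_boundary_superset:
  assumes "finite S" "Poly_Mapping.keys c \<subseteq> S"
  shows "chain_boundary c = (\<Sum>\<sigma>\<in>S. \<Sum>v\<in>{v \<in> \<sigma>. \<sigma> \<noteq> {v}}.
        Poly_Mapping.single (\<sigma> - {v}) ((-1) ^ vertex_index \<sigma> v * Poly_Mapping.lookup c \<sigma>))"
  unfolding chain_boundary_def
  by (rule sum.mono_neutral_left) (use assms in \<open>auto simp: in_keys_iff\<close>)

lemma chain_boundary_add: "chain_boundary (a + b) = chain_boundary a + chain_boundary b"
proof -
  let ?S = "Poly_Mapping.keys a \<union> Poly_Mapping.keys b"
  have f: "finite ?S" by simp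
  have "Poly_Mapping.keys (a + b) \<subseteq> ?S" by (rule keys_add)
  from chain_boundary_superset[OF f this] show ?thesis
    by (simp add: chain_boundary_superset[OF f, of a] chain_boundary_superset[OF f, of b]
        lookup_add single_add distrib_left sum.distrib)
qed

lemma chain_boundary_0 [simp]: "chain_boundary 0 = 0"
  by (simp add: chain_boundary_def)

lemma chain_boundary_sum: "chain_boundary (\<Sum>i\<in>I. f i) = (\<Sum>i\<in>I. chain_boundary (f i))"
  by (induction I rule: infinite_finite_induct) (auto simp: chain_boundary_add)

lemma chain_scale_single: "chain_scale r (Poly_Mapping.single \<sigma> c) = Poly_Mapping.single \<sigma> (r * c)"
  by (rule poly_mapping_eqI) (simp add: lookup_single when_def)

lemma chain_scale_0 [simp]: "chain_scale r 0 = 0"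
  by (rule poly_mapping_eqI) simp

lemma chain_scale_sum: "chain_scale r (\<Sum>i\<in>I. f i) = (\<Sum>i\<in>I. chain_scale r (f i))"
  by (induction I rule: infinite_finite_induct) (auto simp: chain_scale_add_right)

lemma chain_boundary_scale: "chain_boundary (chain_scale r c) = chain_scale r (chain_boundary c)"
proof -
  have f: "finite (Poly_Mapping.keys c)" by simp
  show ?thesis
    by (simp add: chain_boundary_superset[OF f keys_chain_scale] chain_boundary_superset[OF f order_refl]
        chain_scale_sum chain_scale_single mult.left_commute)
qed

lemma chain_boundary_diff: "chain_boundary (a - b) = chain_boundary a - chain_boundary b"
  using chain_boundary_add[of "a - b" b] by simp

lemma chains_add: "a \<in> chains k K \<Longrightarrow> b \<in> chains k K \<Longrightarrow> a + b \<in> chains k K"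
  unfolding chains_def using keys_add[of a b] by blast

lemma chains_0 [simp]: "0 \<in> chains k K"
  by (simp add: chains_def)

lemma chains_scale: "a \<in> chains k K \<Longrightarrow> chain_scale r a \<in> chains k K"
  unfolding chains_def using keys_chain_scale[of r a] by blast

lemma chains_diff: "a \<in> chains k K \<Longrightarrow> b \<in> chains k K \<Longrightarrow> a - b \<in> chains k K"
  using chains_add[of a k K "chain_scale (-1) b"] chains_scale[of b k K "-1"]
  by (simp add: chain_scale_minus_one)

lemma chains_sum: "(\<And>i. i \<in> I \<Longrightarrow> f i \<in> chains k K) \<Longrightarrow> (\<Sum>i\<in>I. f i) \<in> chains k K"
  by (induction I rule: infinite_finite_induct) (auto intro: chains_add)

lemma chains_mono: "K \<subseteq> L \<Longrightarrow> chains k K \<subseteq> chains k L"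
  by (auto simp: chains_def simplices_def)

lemma cycles_add: "a \<in> cycles k K \<Longrightarrow> b \<in> cycles k K \<Longrightarrow> a + b \<in> cycles k K"
  by (auto simp: cycles_def chains_add chain_boundary_add)

lemma cycles_diff: "a \<in> cycles k K \<Longrightarrow> b \<in> cycles k K \<Longrightarrow> a - b \<in> cycles k K"
  by (auto simp: cycles_def chains_diff chain_boundary_diff)

lemma cycles_scale: "a \<in> cycles k K \<Longrightarrow> chain_scale r a \<in> cycles k K"
  by (auto simp: cycles_def chains_scale chain_boundary_scale)

lemma cycles_mono: "K \<subseteq> L \<Longrightarrow> cycles k K \<subseteq> cycles k L"
  using chains_mono[of K L k] by (auto simp: cycles_def)

lemma boundaries_add: "a \<in> boundaries k K \<Longrightarrow> b \<in> boundaries k K \<Longrightarrow> a + b \<in> boundaries k K"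
  by (auto simp: boundaries_def chain_boundary_add[symmetric] intro!: imageI chains_add)

lemma boundaries_diff: "a \<in> boundaries k K \<Longrightarrow> b \<in> boundaries k K \<Longrightarrow> a - b \<in> boundaries k K"
  by (auto simp: boundaries_def chain_boundary_diff[symmetric] intro!: imageI chains_diff)

lemma boundaries_scale: "a \<in> boundaries k K \<Longrightarrow> chain_scale r a \<in> boundaries k K"
  by (auto simp: boundaries_def chain_boundary_scale[symmetric] intro!: imageI chains_scale)

lemma boundaries_0 [simp]: "0 \<in> boundaries k K"
  unfolding boundaries_def by (rule image_eqI[where x = 0]) auto

lemma boundaries_mono: "K \<subseteq> L \<Longrightarrow> boundaries k K \<subseteq> boundaries k L"
  unfolding boundaries_def by (intro image_mono chains_mono)

section \<open>Homology classes as cosets of boundaries\<close>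

lemma mem_homology_class_iff: "x \<in> homology_class k K z \<longleftrightarrow> x - z \<in> boundaries k K"
proof
  assume "x - z \<in> boundaries k K"
  then have "x = z + (x - z) \<and> x - z \<in> boundaries k K" by simp
  then show "x \<in> homology_class k K z" unfolding homology_class_def by blast
qed (auto simp: homology_class_def)

lemma homology_class_eq_iff:
  "homology_class k K z = homology_class k K w \<longleftrightarrow> z - w \<in> boundaries k K"
proof
  assume "homology_class k K z = homology_class k K w"
  then have "z \<in> homology_class k K w"
    using mem_homology_class_iff[of z k K z] by simp
  then show "z - w \<in> boundaries k K" by (simp add: mem_homology_class_iff)
next
  assume a: "z - w \<in> boundaries k K"
  have "x - z \<in> boundaries k K \<longleftrightarrow> x - w \<in> boundaries k K" for x
    using boundaries_add[OF _ a, of "x - z"] boundaries_diff[OF _ a, of "x - w"] by auto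
  then show "homology_class k K z = homology_class k K w"
    by (simp add: set_eq_iff mem_homology_class_iff)
qed

lemma homology_class_add:
  "{x + y |x y. x \<in> homology_class k K z \<and> y \<in> homology_class k K w} = homology_class k K (z + w)"
proof (intro equalityI subsetI)
  fix u assume "u \<in> {x + y |x y. x \<in> homology_class k K z \<and> y \<in> homology_class k K w}"
  then obtain x y where "u = x + y" "x - z \<in> boundaries k K" "y - w \<in> boundaries k K"
    by (auto simp: mem_homology_class_iff)
  then show "u \<in> homology_class k K (z + w)"
    using boundaries_add[of "x - z" k K "y - w"] by (simp add: mem_homology_class_iff add_diff_add)
next
  fix u assume "u \<in> homology_class k K (z + w)"
  then have "u - w \<in> homology_class k K z" "w \<in> homology_class k K w"
    by (simp_all add: mem_homology_class_iff diff_diff_eq add.commute)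
  then have "(u - w) + w \<in> {x + y |x y. x \<in> homology_class k K z \<and> y \<in> homology_class k K w}"
    by blast
  then show "u \<in> {x + y |x y. x \<in> homology_class k K z \<and> y \<in> homology_class k K w}"
    by simp
qed

lemma homology_class_scale:
  "{chain_scale r x + b |x b. x \<in> homology_class k K z \<and> b \<in> boundaries k K}
     = homology_class k K (chain_scale r z)"
proof (intro equalityI subsetI)
  fix u assume "u \<in> {chain_scale r x + b |x b. x \<in> homology_class k K z \<and> b \<in> boundaries k K}"
  then obtain c b where "u = chain_scale r (z + c) + b" "c \<in> boundaries k K" "b \<in> boundaries k K"
    by (auto simp: homology_class_def)
  then show "u \<in> homology_class k K (chain_scale r z)"
    using boundaries_add[OF boundaries_scale[of c k K r], of b]
    by (simp add: mem_homology_class_iff chain_scale_add_right)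
next
  fix u assume "u \<in> homology_class k K (chain_scale r z)"
  then have "z \<in> homology_class k K z" "u - chain_scale r z \<in> boundaries k K"
    by (simp_all add: mem_homology_class_iff)
  then have "chain_scale r z + (u - chain_scale r z)
      \<in> {chain_scale r x + b |x b. x \<in> homology_class k K z \<and> b \<in> boundaries k K}"
    by blast
  then show "u \<in> {chain_scale r x + b |x b. x \<in> homology_class k K z \<and> b \<in> boundaries k K}"
    by simp
qed

text \<open>Boundaries only grow from \<open>K\<close> to \<open>L\<close>, so all representatives
  of a class over \<open>K\<close> have the same class over \<open>L\<close> and the union
  collapses.\<close>

lemma homology_inclusion_class:
  assumes "K \<subseteq> L"
  shows "homology_inclusion k L (homology_class k K z) = homology_class k L z"
proof -
  have eq: "homology_class k L x = homology_class k L z" if "x \<in> homology_class k K z" for x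
    using that boundaries_mono[OF assms, of k] by (auto simp: homology_class_eq_iff mem_homology_class_iff)
  have "z \<in> homology_class k K z" by (simp add: mem_homology_class_iff)
  then show ?thesis unfolding homology_inclusion_def by (intro SUP_eq_const eq) auto
qed


section \<open>Barcodes from linear functionals\<close>

text \<open>
  Functionals on chains that do not depend on the filtration parameter serve as coordinates of an
  interval decomposition: the structure maps then only forget coordinates.
\<close>

lemma has_barcode_persistent_homologyI:
  fixes K :: "real \<Rightarrow> 'a set set" and \<psi> :: "nat \<Rightarrow> ('a set \<Rightarrow>\<^sub>0 'k::field) \<Rightarrow> 'k"
  assumes bars: "\<And>a b. (a, b) \<in> set bs \<Longrightarrow> 0 \<le> a \<and> ereal a < b"
    and mono: "\<And>\<epsilon> \<delta>. 0 \<le> \<epsilon> \<Longrightarrow> \<epsilon> \<le> \<delta> \<Longrightarrow> K \<epsilon> \<subseteq> K \<delta>"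
    and add: "\<And>i z w. \<psi> i (z + w) = \<psi> i z + \<psi> i w"
    and scale: "\<And>i r z. \<psi> i (chain_scale r z) = r * \<psi> i z"
    and born: "\<And>i \<epsilon> z. \<lbrakk>i < length bs; 0 \<le> \<epsilon>; \<epsilon> < fst (bs ! i); z \<in> cycles k (K \<epsilon>)\<rbrakk> \<Longrightarrow> \<psi> i z = 0"
    and ker: "\<And>\<epsilon> z. \<lbrakk>0 \<le> \<epsilon>; z \<in> cycles k (K \<epsilon>)\<rbrakk> \<Longrightarrow>
      z \<in> boundaries k (K \<epsilon>) \<longleftrightarrow> (\<forall>i<length bs. in_bar \<epsilon> (bs ! i) \<longrightarrow> \<psi> i z = 0)"
    and surj: "\<And>\<epsilon> x. 0 \<le> \<epsilon> \<Longrightarrow>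
      \<exists>z\<in>cycles k (K \<epsilon>). \<forall>i<length bs. in_bar \<epsilon> (bs ! i) \<longrightarrow> \<psi> i z = x i"
  shows "has_barcode (persistent_homology k K :: ('k, ('a set \<Rightarrow>\<^sub>0 'k) set) pmodule) bs"
proof -
  let ?H = "\<lambda>\<epsilon>. homology k (K \<epsilon>) :: ('k, ('a set \<Rightarrow>\<^sub>0 'k) set) vspace"
  let ?Q = "persistent_homology k K :: ('k, ('a set \<Rightarrow>\<^sub>0 'k) set) pmodule"
  define \<phi> where "\<phi> \<epsilon> z i = (if i < length bs \<and> in_bar \<epsilon> (bs ! i) then \<psi> i z else 0)" for \<epsilon> z i
  \<comment> \<open>A class is sent to the coordinates of a chosen representative. The fact
    \<open>same\<close> below makes this independent of the choice and injective at once.\<close>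
  define \<Phi> where "\<Phi> \<epsilon> A = \<phi> \<epsilon> (SOME z. z \<in> cycles k (K \<epsilon>) \<and> homology_class k (K \<epsilon>) z = A)" for \<epsilon> A
  have diff: "\<psi> i (z - w) = \<psi> i z - \<psi> i w" for i z w
    using add[of i "z - w" w] by simp
  have same: "homology_class k (K \<epsilon>) z = homology_class k (K \<epsilon>) w \<longleftrightarrow> \<phi> \<epsilon> z = \<phi> \<epsilon> w"
    if "0 \<le> \<epsilon>" "z \<in> cycles k (K \<epsilon>)" "w \<in> cycles k (K \<epsilon>)" for \<epsilon> z w
    unfolding homology_class_eq_iff ker[OF that(1) cycles_diff[OF that(2,3)]]
    by (auto simp: \<phi>_def diff fun_eq_iff)
  have \<Phi>: "\<Phi> \<epsilon> (homology_class k (K \<epsilon>) z) = \<phi> \<epsilon> z" if "0 \<le> \<epsilon>" "z \<in> cycles k (K \<epsilon>)" for \<epsilon> z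
  proof -
    let ?P = "\<lambda>w. w \<in> cycles k (K \<epsilon>) \<and> homology_class k (K \<epsilon>) w = homology_class k (K \<epsilon>) z"
    have "?P (Eps ?P)" using that by (intro someI[of ?P z]) auto
    then show ?thesis using same[OF that(1) _ that(2), of "Eps ?P"] unfolding \<Phi>_def by simp
  qed
  have "vspace_iso (?H \<epsilon>) (pspace (interval_sum bs) \<epsilon>) (\<Phi> \<epsilon>)" if e: "0 \<le> \<epsilon>" for \<epsilon>
    unfolding vspace_iso_def
  proof (intro conjI ballI allI)
    show "bij_betw (\<Phi> \<epsilon>) (vcarrier (?H \<epsilon>)) (vcarrier (pspace (interval_sum bs) \<epsilon>))"
      unfolding bij_betw_def
    proof
      show "inj_on (\<Phi> \<epsilon>) (vcarrier (?H \<epsilon>))"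
        by (auto simp: inj_on_def homology_def \<Phi>[OF e] same[OF e])
      have "\<exists>z\<in>cycles k (K \<epsilon>). \<phi> \<epsilon> z = x" if "x \<in> vcarrier (pspace (interval_sum bs) \<epsilon>)" for x
      proof -
        obtain z where "z \<in> cycles k (K \<epsilon>)" "\<forall>i<length bs. in_bar \<epsilon> (bs ! i) \<longrightarrow> \<psi> i z = x i"
          using surj[OF e, of x] by blast
        moreover have "\<phi> \<epsilon> z = x"
          using that calculation(2) by (fastforce simp: \<phi>_def fun_eq_iff interval_sum_def)
        ultimately show ?thesis by blast
      qed
      moreover have "\<phi> \<epsilon> z \<in> vcarrier (pspace (interval_sum bs) \<epsilon>)" for z
        by (simp add: interval_sum_def \<phi>_def)
      ultimately have "\<phi> \<epsilon> ` cycles k (K \<epsilon>) = vcarrier (pspace (interval_sum bs) \<epsilon>)"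
        by blast
      then show "\<Phi> \<epsilon> ` vcarrier (?H \<epsilon>) = vcarrier (pspace (interval_sum bs) \<epsilon>)"
        by (simp add: homology_def image_image \<Phi>[OF e] cong: image_cong_simp)
    qed
  next
    fix x y assume "x \<in> vcarrier (?H \<epsilon>)" "y \<in> vcarrier (?H \<epsilon>)"
    then show "\<Phi> \<epsilon> (vadd (?H \<epsilon>) x y) = vadd (pspace (interval_sum bs) \<epsilon>) (\<Phi> \<epsilon> x) (\<Phi> \<epsilon> y)"
      by (auto simp: homology_def homology_class_add \<Phi>[OF e] cycles_add interval_sum_def \<phi>_def add)
  next
    fix r x assume "x \<in> vcarrier (?H \<epsilon>)"
    then show "\<Phi> \<epsilon> (vscale (?H \<epsilon>) r x) = vscale (pspace (interval_sum bs) \<epsilon>) r (\<Phi> \<epsilon> x)"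
      by (auto simp: homology_def homology_class_scale \<Phi>[OF e] cycles_scale interval_sum_def \<phi>_def scale)
  qed
  moreover have "\<Phi> \<delta> (homology_inclusion k (K \<delta>) x) = pmap (interval_sum bs) \<epsilon> \<delta> (\<Phi> \<epsilon> x)"
    if that: "0 \<le> \<epsilon>" "\<epsilon> \<le> \<delta>" and x: "x \<in> vcarrier (?H \<epsilon>)" for \<epsilon> \<delta> x
  proof -
    obtain z where z: "x = homology_class k (K \<epsilon>) z" "z \<in> cycles k (K \<epsilon>)"
      using x by (auto simp: homology_def)
    have z': "z \<in> cycles k (K \<delta>)" using z(2) cycles_mono[OF mono[OF that(1,2)]] by blast
    \<comment> \<open>Naturality can fail only on a bar alive at \<delta> but not at \<epsilon>.
      Since \<epsilon> \<le> \<delta>, such a bar has not ended at \<epsilon>, so it is not yet born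
      there and its functional vanishes on \<open>z\<close>.\<close>
    have "\<psi> i z = 0" if "i < length bs" "in_bar \<delta> (bs ! i)" "\<not> in_bar \<epsilon> (bs ! i)" for i
    proof (rule born[OF that(1) \<open>0 \<le> \<epsilon>\<close> _ z(2)])
      have "ereal \<epsilon> < snd (bs ! i)"
        using that(2) \<open>\<epsilon> \<le> \<delta>\<close> by (auto simp: in_bar_def intro: le_less_trans[of _ "ereal \<delta>"])
      then show "\<epsilon> < fst (bs ! i)" using that(3) by (auto simp: in_bar_def)
    qed
    then have "\<phi> \<delta> z = pmap (interval_sum bs) \<epsilon> \<delta> (\<phi> \<epsilon> z)"
      by (auto simp: \<phi>_def interval_sum_def fun_eq_iff)
    then show ?thesis
      using that z z' by (simp add: homology_inclusion_class[OF mono[OF that(1,2)]] \<Phi>)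
  qed
  ultimately have "pmodule_isomorphic ?Q (interval_sum bs)"
    unfolding pmodule_isomorphic_def persistent_homology_def by (intro exI[of _ \<Phi>]) simp
  then show ?thesis
    unfolding has_barcode_def using bars by blast
qed


section \<open>Uniqueness of persistent magnitude\<close>

text \<open>Turns coordinate sequences into an instance of \<open>vector_space\<close>, so that
  independent sets can be compared with spanning sets.\<close>

definition coordinatewise_scale :: "'k::field \<Rightarrow> (nat \<Rightarrow> 'k) \<Rightarrow> nat \<Rightarrow> 'k" where
  "coordinatewise_scale r x = (\<lambda>i. r * x i)"

lemma vector_space_coordinatewise_scale: "vector_space coordinatewise_scale"
  by unfold_locales (auto simp: coordinatewise_scale_def fun_eq_iff algebra_simps)

text \<open>Going back along \<open>f\<close> and forward along \<open>g\<close> is a linear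
  bijection \<open>h\<close> between the two coordinate spaces, so the images of the unit vectors
  indexed by \<open>S\<close> are independent in the span of those indexed by \<open>T\<close>.
  Closure is assumed because \<open>V\<close> is a bare record: inverting \<open>f\<close> linearly
  requires sums and multiples to stay in the carrier.\<close>

lemma card_le_of_coordinate_iso:
  fixes V :: "('k::field, 'v) vspace"
  assumes closed: "\<And>x y. x \<in> vcarrier V \<Longrightarrow> y \<in> vcarrier V \<Longrightarrow> vadd V x y \<in> vcarrier V"
     "\<And>r x. x \<in> vcarrier V \<Longrightarrow> vscale V r x \<in> vcarrier V"
    and f: "vspace_iso V \<lparr>vcarrier = {x. \<forall>i::nat. x i \<noteq> 0 \<longrightarrow> i \<in> S}, vadd = (\<lambda>x y i. x i + y i),
         vscale = (\<lambda>r x i. r * x i)\<rparr> f"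
    and g: "vspace_iso V \<lparr>vcarrier = {x. \<forall>i::nat. x i \<noteq> 0 \<longrightarrow> i \<in> T}, vadd = (\<lambda>x y i. x i + y i),
         vscale = (\<lambda>r x i. r * x i)\<rparr> g"
    and "finite S" "finite T"
  shows "card S \<le> card T"
proof -
  let ?W = "\<lambda>S. {x :: nat \<Rightarrow> 'k. \<forall>i. x i \<noteq> 0 \<longrightarrow> i \<in> S}"
  define e where "e j = (\<lambda>i. if i = j then 1 else 0 :: 'k)" for j :: nat
  define h where "h = g \<circ> inv_into (vcarrier V) f"
  have bf: "bij_betw f (vcarrier V) (?W S)" and bg: "bij_betw g (vcarrier V) (?W T)"
    using f g by (auto simp: vspace_iso_def)
  have bi: "bij_betw (inv_into (vcarrier V) f) (?W S) (vcarrier V)" using bf by (rule bij_betw_inv_into)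
  have bh: "bij_betw h (?W S) (?W T)" unfolding h_def using bi bg by (rule bij_betw_trans)
  have inv: "inv_into (vcarrier V) f x \<in> vcarrier V" if "x \<in> ?W S" for x
    using bij_betwE[OF bi] that by blast
  have finv: "f (inv_into (vcarrier V) f x) = x" if "x \<in> ?W S" for x
    using bf that by (rule bij_betw_inv_into_right)
  have hadd: "h (\<lambda>i. x i + y i) = (\<lambda>i. h x i + h y i)" if "x \<in> ?W S" "y \<in> ?W S" for x y
  proof -
    let ?x = "inv_into (vcarrier V) f x" and ?y = "inv_into (vcarrier V) f y"
    have "f (vadd V ?x ?y) = (\<lambda>i. x i + y i)"
      using f inv[OF that(1)] inv[OF that(2)] by (simp add: vspace_iso_def finv[OF that(1)] finv[OF that(2)])
    then have "inv_into (vcarrier V) f (\<lambda>i. x i + y i) = vadd V ?x ?y"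
      using bij_betw_inv_into_left[OF bf closed(1)[OF inv[OF that(1)] inv[OF that(2)]]] by simp
    then show ?thesis using g inv[OF that(1)] inv[OF that(2)] by (simp add: h_def vspace_iso_def)
  qed
  have hscale: "h (\<lambda>i. r * x i) = (\<lambda>i. r * h x i)" if "x \<in> ?W S" for r x
  proof -
    let ?x = "inv_into (vcarrier V) f x"
    have "f (vscale V r ?x) = (\<lambda>i. r * x i)"
      using f inv[OF that] by (simp add: vspace_iso_def finv[OF that])
    then have "inv_into (vcarrier V) f (\<lambda>i. r * x i) = vscale V r ?x"
      using bij_betw_inv_into_left[OF bf closed(2)[OF inv[OF that], of r]] by simp
    then show ?thesis using g inv[OF that] by (simp add: h_def vspace_iso_def)
  qed
  \<comment> \<open>\<open>vspace_iso\<close> does not mention zero, which is recovered as a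
    multiple by the scalar 0.\<close>
  have h0: "h (\<lambda>i. 0) = (\<lambda>i. 0)" using hscale[of "\<lambda>i. 0" 0] by simp
  have eW: "e j \<in> ?W S" if "j \<in> S" for j using that by (auto simp: e_def)
  have hsum: "h (\<lambda>i. \<Sum>j\<in>J. u j * e j i) = (\<lambda>i. \<Sum>j\<in>J. u j * h (e j) i)" if "finite J" "J \<subseteq> S" for J u
    using that
  proof (induction J rule: finite_induct)
    case empty then show ?case by (simp add: h0)
  next
    case (insert a J)
    have "(\<lambda>i. u a * e a i) \<in> ?W S" using insert.prems by (auto simp: e_def)
    moreover have "(\<lambda>i. \<Sum>j\<in>J. u j * e j i) \<in> ?W S"
    proof (clarify)
      fix i assume "(\<Sum>j\<in>J. u j * e j i) \<noteq> 0"
      then obtain j where "j \<in> J" "u j * e j i \<noteq> 0" by (meson sum.not_neutral_contains_not_neutral)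
      then show "i \<in> S" using insert.prems by (auto simp: e_def split: if_splits)
    qed
    ultimately have "h (\<lambda>i. u a * e a i + (\<Sum>j\<in>J. u j * e j i))
        = (\<lambda>i. h (\<lambda>i. u a * e a i) i + h (\<lambda>i. \<Sum>j\<in>J. u j * e j i) i)"
      by (rule hadd)
    also have "h (\<lambda>i. u a * e a i) = (\<lambda>i. u a * h (e a) i)"
      using insert.prems by (intro hscale eW) simp
    finally show ?case
      using insert by simp
  qed
  have esum: "(\<lambda>i. \<Sum>j\<in>J. u j * e j i) = (\<lambda>i. if i \<in> J then u i else 0)" if "finite J" for J u
  proof
    fix i
    have "(\<Sum>j\<in>J. u j * e j i) = (\<Sum>j\<in>J. if i = j then u j else 0)"
      by (rule sum.cong) (auto simp: e_def)
    then show "(\<Sum>j\<in>J. u j * e j i) = (if i \<in> J then u i else 0)" using that by simp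
  qed
  have fun_sum: "(\<Sum>j\<in>J. F j) = (\<lambda>i. \<Sum>j\<in>J. F j i)" for J and F :: "nat \<Rightarrow> nat \<Rightarrow> 'k"
    by (induction J rule: infinite_finite_induct) (auto simp: fun_eq_iff)
  have inje: "inj_on (\<lambda>j. h (e j)) S"
  proof (rule inj_onI)
    fix i j assume ij: "i \<in> S" "j \<in> S" and eq: "h (e i) = h (e j)"
    from bij_betw_imp_inj_on[OF bh] eq eW[OF ij(1)] eW[OF ij(2)] have "e i = e j"
      by (rule inj_onD)
    then have "e i i = e j i" by (rule fun_cong)
    then show "i = j" by (simp add: e_def split: if_splits)
  qed
  interpret vs: vector_space "coordinatewise_scale :: 'k \<Rightarrow> _"
    by (rule vector_space_coordinatewise_scale)
  have "vs.independent ((\<lambda>j. h (e j)) ` S)"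
    unfolding vs.independent_explicit_finite_subsets
  proof (intro allI impI ballI)
    fix A u v
    assume A: "A \<subseteq> (\<lambda>j. h (e j)) ` S" "finite A" and s: "(\<Sum>v\<in>A. coordinatewise_scale (u v) v) = 0" and v: "v \<in> A"
    obtain J where J: "J \<subseteq> S" "A = (\<lambda>j. h (e j)) ` J" using A(1) by (rule subset_imageE)
    have inj: "inj_on (\<lambda>j. h (e j)) J" using inje J(1) by (rule inj_on_subset)
    have fJ: "finite J" using A(2) inj by (simp add: J(2) finite_image_iff)
    let ?u = "\<lambda>j. u (h (e j))"
    have "(\<lambda>i. \<Sum>j\<in>J. ?u j * h (e j) i) = (\<Sum>j\<in>J. coordinatewise_scale (?u j) (h (e j)))"
      by (simp only: fun_sum coordinatewise_scale_def)
    also have "\<dots> = (\<Sum>v\<in>A. coordinatewise_scale (u v) v)"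
      unfolding J(2) by (simp only: sum.reindex[OF inj] o_def)
    also have "\<dots> = (\<lambda>i. 0)" unfolding s by (rule zero_fun_def)
    \<comment> \<open>A vanishing combination of the images is \<open>h\<close> applied to the
      coefficient sequence itself, so injectivity of \<open>h\<close> kills the
      coefficients.\<close>
    finally have eq: "h (\<lambda>i. if i \<in> J then ?u i else 0) = h (\<lambda>i. 0)"
      using hsum[OF fJ J(1), of ?u] unfolding esum[OF fJ] h0 by (simp only:)
    have mem: "(\<lambda>i. if i \<in> J then ?u i else 0) \<in> ?W S" "(\<lambda>i. 0) \<in> ?W S" using J(1) by auto
    have u0: "(\<lambda>i. if i \<in> J then ?u i else 0) = (\<lambda>i. 0)"
      by (rule inj_onD[OF bij_betw_imp_inj_on[OF bh] eq mem])
    have "?u j = 0" if "j \<in> J" for j using fun_cong[OF u0, of j] that by simp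
    moreover obtain j where "j \<in> J" "v = h (e j)" using v unfolding J(2) by (rule imageE)
    ultimately show "u v = 0" by simp
  qed
  moreover have "(\<lambda>j. h (e j)) ` S \<subseteq> vs.span (e ` T)"
  proof clarify
    fix j assume "j \<in> S"
    then have "h (e j) \<in> ?W T" using bij_betwE[OF bh] eW by blast
    then have "h (e j) = (\<lambda>i. if i \<in> T then h (e j) i else 0)" by (intro ext) auto
    also have "\<dots> = (\<Sum>l\<in>T. coordinatewise_scale (h (e j) l) (e l))"
      by (simp add: coordinatewise_scale_def fun_sum esum[OF \<open>finite T\<close>])
    also have "\<dots> \<in> vs.span (e ` T)"
      by (rule vs.span_sum, rule vs.span_scale, rule vs.span_base) (rule imageI)
    finally show "h (e j) \<in> vs.span (e ` T)" .
  qed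
  ultimately have "card ((\<lambda>j. h (e j)) ` S) \<le> card (e ` T)"
    using \<open>finite T\<close> vs.independent_span_bound[of "e ` T" "(\<lambda>j. h (e j)) ` S"] by simp
  also have "\<dots> \<le> card T" using \<open>finite T\<close> by (rule card_image_le)
  finally show ?thesis by (simp add: card_image[OF inje])
qed

text \<open>The number of bars alive at \<epsilon> is the dimension of the homology at \<epsilon>,
  whichever barcode is used.\<close>

lemma card_bars_le:
  assumes "has_barcode (persistent_homology k K :: ('k::field, ('a set \<Rightarrow>\<^sub>0 'k) set) pmodule) bs"
    and "has_barcode (persistent_homology k K :: ('k, ('a set \<Rightarrow>\<^sub>0 'k) set) pmodule) cs"
    and "0 \<le> \<epsilon>"
  shows "card {i. i < length bs \<and> in_bar \<epsilon> (bs ! i)} \<le> card {i. i < length cs \<and> in_bar \<epsilon> (cs ! i)}"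
proof -
  let ?V = "homology k (K \<epsilon>) :: ('k, ('a set \<Rightarrow>\<^sub>0 'k) set) vspace"
  have ex: "\<exists>f. vspace_iso ?V (pspace (interval_sum ds) \<epsilon>) f"
    if "has_barcode (persistent_homology k K :: ('k, ('a set \<Rightarrow>\<^sub>0 'k) set) pmodule) ds" for ds
    using that \<open>0 \<le> \<epsilon>\<close> by (auto simp: has_barcode_def pmodule_isomorphic_def persistent_homology_def)
  obtain f g where "vspace_iso ?V (pspace (interval_sum bs) \<epsilon>) f" "vspace_iso ?V (pspace (interval_sum cs) \<epsilon>) g"
    using ex[OF assms(1)] ex[OF assms(2)] by blast
  then show ?thesis
    by (intro card_le_of_coordinate_iso[of ?V _ f _ g])
      (auto simp: interval_sum_def homology_def homology_class_add homology_class_scale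
        intro!: imageI cycles_add cycles_scale)
qed

text \<open>The indicator of a finite bar is the difference of two half-line indicators, which
  reduces everything to the tail integral of the exponential.\<close>

lemma has_integral_bar_magnitude:
  assumes "0 \<le> a" "ereal a < b"
  shows "((\<lambda>s. if in_bar s (a, b) then exp (- s) else 0) has_integral bar_magnitude (a, b)) {0..}"
proof -
  have tail: "((\<lambda>s::real. exp (- s)) has_integral exp (- c)) {c..}" for c :: real
    using has_integral_exp_minus_to_infinity[of 1 c] by simp
  have step: "((\<lambda>s. if c \<le> s then exp (- s) else 0) has_integral exp (- c)) {0..}" if "0 \<le> c" for c :: real
  proof -
    have "((\<lambda>s. if s \<in> {c..} then exp (- s) else 0) has_integral exp (- c)) {0..}"
      using that by (subst has_integral_restrict) (auto intro: tail)
    then show ?thesis by simp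
  qed
  show ?thesis
  proof (cases b)
    case (real r)
    then have "a < r" using assms by simp
    show ?thesis
      using has_integral_diff[OF step[of a] step[of r]] assms \<open>a < r\<close> real
      by (auto simp: in_bar_def bar_magnitude_def elim!: has_integral_eq[rotated])
  next
    case PInf
    then show ?thesis using step[OF assms(1)] by (simp add: in_bar_def bar_magnitude_def)
  qed (use assms in auto)
qed

text \<open>
  Uniqueness of barcodes is not needed: the total magnitude of a barcode is the integral of
  \<open>exp (- s)\<close> against the pointwise dimension of the module.
\<close>

lemma has_integral_total_bar_magnitude:
  assumes "\<And>a b. (a, b) \<in> set bs \<Longrightarrow> 0 \<le> a \<and> ereal a < b"
  shows "((\<lambda>s. real (card {i. i < length bs \<and> in_bar s (bs ! i)}) * exp (- s))
           has_integral (\<Sum>I\<leftarrow>bs. bar_magnitude I)) {0..}"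
proof -
  have "((\<lambda>s. \<Sum>i<length bs. if in_bar s (bs ! i) then exp (- s) else 0)
           has_integral (\<Sum>i<length bs. bar_magnitude (bs ! i))) {0..}"
  proof (intro has_integral_sum)
    fix i assume "i \<in> {..<length bs}"
    then have "(fst (bs ! i), snd (bs ! i)) \<in> set bs" by simp
    from assms[OF this] show "((\<lambda>s. if in_bar s (bs ! i) then exp (- s) else 0)
           has_integral bar_magnitude (bs ! i)) {0..}"
      using has_integral_bar_magnitude[of "fst (bs ! i)" "snd (bs ! i)"] by simp
  qed simp
  moreover have "(\<Sum>i<length bs. if in_bar s (bs ! i) then exp (- s) else 0)
      = real (card {i. i < length bs \<and> in_bar s (bs ! i)}) * exp (- s)" for s
    by (simp add: sum.If_cases Int_def)
  ultimately show ?thesis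
    by (simp add: sum_list_sum_nth atLeast0LessThan)
qed

lemma total_bar_magnitude_unique:
  assumes "has_barcode (persistent_homology k K :: ('k::field, ('a set \<Rightarrow>\<^sub>0 'k) set) pmodule) bs"
    and "has_barcode (persistent_homology k K :: ('k, ('a set \<Rightarrow>\<^sub>0 'k) set) pmodule) cs"
  shows "(\<Sum>I\<leftarrow>bs. bar_magnitude I) = (\<Sum>I\<leftarrow>cs. bar_magnitude I)"
proof -
  have "card {i. i < length bs \<and> in_bar s (bs ! i)} = card {i. i < length cs \<and> in_bar s (cs ! i)}"
    if "0 \<le> s" for s
    using card_bars_le[OF assms that] card_bars_le[OF assms(2,1) that] by simp
  then have "((\<lambda>s. real (card {i. i < length bs \<and> in_bar s (bs ! i)}) * exp (- s))
           has_integral (\<Sum>I\<leftarrow>cs. bar_magnitude I)) {0..}"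
    using assms(2) by (intro has_integral_eq[OF _ has_integral_total_bar_magnitude])
      (auto simp: has_barcode_def)
  then show ?thesis
    using assms(1) by (intro has_integral_unique[OF has_integral_total_bar_magnitude])
      (auto simp: has_barcode_def)
qed

lemma persistent_magnitude_eqI:
  fixes F :: "'k::field itself" and K :: "real \<Rightarrow> 'a set set"
  assumes "has_persistent_magnitude F K M"
  shows "persistent_magnitude F K = M"
  unfolding persistent_magnitude_def
proof (rule the_equality)
  show "has_persistent_magnitude F K M" by (rule assms)
next
  fix M' assume "has_persistent_magnitude F K M'"
  then obtain bs where bs: "\<And>k. has_barcode (persistent_homology k K :: ('k, ('a set \<Rightarrow>\<^sub>0 'k) set) pmodule) (bs k)"
      "(\<lambda>k. (-1) ^ k * (\<Sum>I\<leftarrow>bs k. bar_magnitude I)) sums M'"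
    unfolding has_persistent_magnitude_def by blast
  obtain cs where cs: "\<And>k. has_barcode (persistent_homology k K :: ('k, ('a set \<Rightarrow>\<^sub>0 'k) set) pmodule) (cs k)"
      "(\<lambda>k. (-1) ^ k * (\<Sum>I\<leftarrow>cs k. bar_magnitude I)) sums M"
    using assms unfolding has_persistent_magnitude_def by blast
  have "(\<Sum>I\<leftarrow>bs k. bar_magnitude I) = (\<Sum>I\<leftarrow>cs k. bar_magnitude I)" for k
    using bs(1) cs(1) by (rule total_bar_magnitude_unique)
  then show "M' = M" using bs(2) cs(2) by (simp add: sums_unique2)
qed


section \<open>Acyclicity of the full simplex\<close>

lemma sum_single_lookup:
  assumes "finite S" "Poly_Mapping.keys c \<subseteq> S"
  shows "c = (\<Sum>\<sigma>\<in>S. Poly_Mapping.single \<sigma> (Poly_Mapping.lookup c \<sigma>))"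
proof (rule poly_mapping_eqI)
  fix \<tau>
  have "(\<Sum>\<sigma>\<in>S. Poly_Mapping.lookup (Poly_Mapping.single \<sigma> (Poly_Mapping.lookup c \<sigma>)) \<tau>)
      = (\<Sum>\<sigma>\<in>S. if \<sigma> = \<tau> then Poly_Mapping.lookup c \<sigma> else 0)"
    by (rule sum.cong) (auto simp: lookup_single when_def)
  also have "\<dots> = Poly_Mapping.lookup c \<tau>"
    using assms by (auto simp: in_keys_iff)
  finally show "Poly_Mapping.lookup c \<tau>
      = Poly_Mapping.lookup (\<Sum>\<sigma>\<in>S. Poly_Mapping.single \<sigma> (Poly_Mapping.lookup c \<sigma>)) \<tau>"
    by (simp add: lookup_sum)
qed

lemma chain_boundary_single:
  "chain_boundary (Poly_Mapping.single \<sigma> c) =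
     (\<Sum>v\<in>{v \<in> \<sigma>. \<sigma> \<noteq> {v}}. Poly_Mapping.single (\<sigma> - {v}) ((-1) ^ vertex_index \<sigma> v * c))"
proof -
  have "Poly_Mapping.keys (Poly_Mapping.single \<sigma> c) \<subseteq> {\<sigma>}" by simp
  then show ?thesis by (subst chain_boundary_superset[of "{\<sigma>}"]) simp_all
qed

lemma chain_boundary_eq_sum:
  assumes "finite S" "Poly_Mapping.keys c \<subseteq> S"
  shows "chain_boundary c = (\<Sum>\<sigma>\<in>S. chain_boundary (Poly_Mapping.single \<sigma> (Poly_Mapping.lookup c \<sigma>)))"
  unfolding chain_boundary_superset[OF assms] chain_boundary_single ..

text \<open>Provides the apex of the cone. As \<open>vertex_order\<close> is a relation on an
  arbitrary type, the minimum is found by induction instead of by \<open>Min\<close>.\<close>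

lemma ex_vertex_order_minimum:
  assumes "finite V" "V \<noteq> {}"
  shows "\<exists>m\<in>V. \<forall>u\<in>V. (m, u) \<in> vertex_order"
  using assms
proof (induction rule: finite_ne_induct)
  have lin: "refl_on UNIV (vertex_order :: 'a rel)" "trans (vertex_order :: 'a rel)" "total_on UNIV (vertex_order :: 'a rel)"
    using linear_order_vertex_order[where 'a='a] by (auto simp: order_on_defs)
  { case (singleton x)
    show ?case using lin(1) by (auto simp: refl_on_def)
  next
    case (insert x F)
    then obtain m where m: "m \<in> F" "\<forall>u\<in>F. (m, u) \<in> vertex_order" by blast
    show ?case
    proof (cases "(x, m) \<in> vertex_order")
      case True
      then have "\<forall>u\<in>insert x F. (x, u) \<in> vertex_order"
        using m lin(1) transD[OF lin(2) True] by (auto simp: refl_on_def)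
      then show ?thesis by blast
    next
      case False
      then have "(m, x) \<in> vertex_order"
        using lin(1,3) by (metis UNIV_I refl_on_def total_on_def)
      then show ?thesis using m by blast
    qed }
qed

text \<open>A new least vertex moves every other vertex up by one place. Thus the face opposite the
  apex has sign +1 and all other faces change sign, so \<open>cone\<close> can be defined without
  signs.\<close>

lemma vertex_index_insert_minimum:
  assumes "\<forall>u\<in>\<sigma>. (m, u) \<in> vertex_order" "m \<notin> \<sigma>" "finite \<sigma>"
  shows "vertex_index (insert m \<sigma>) m = 0"
    and "u \<in> \<sigma> \<Longrightarrow> vertex_index (insert m \<sigma>) u = Suc (vertex_index \<sigma> u)"
proof -
  have anti: "antisym (vertex_order :: 'a rel)"
    using linear_order_vertex_order[where 'a='a] by (auto simp: order_on_defs)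
  have "{u \<in> insert m \<sigma>. u \<noteq> m \<and> (u, m) \<in> vertex_order} = {}"
    using assms(1) antisymD[OF anti] by auto
  then show "vertex_index (insert m \<sigma>) m = 0" by (simp only: vertex_index_def card.empty)
next
  assume "u \<in> \<sigma>"
  then have "{w \<in> insert m \<sigma>. w \<noteq> u \<and> (w, u) \<in> vertex_order} = insert m {w \<in> \<sigma>. w \<noteq> u \<and> (w, u) \<in> vertex_order}"
    using assms(1,2) by auto
  then show "vertex_index (insert m \<sigma>) u = Suc (vertex_index \<sigma> u)"
    using assms(2,3) by (simp add: vertex_index_def)
qed

text \<open>The join with the apex \<open>m\<close>, a contracting chain homotopy when
  \<open>m\<close> is the least vertex. Simplices that already contain \<open>m\<close> would become
  degenerate and are sent to 0.\<close>

definition cone :: "'a \<Rightarrow> ('a set \<Rightarrow>\<^sub>0 'k::field) \<Rightarrow> ('a set \<Rightarrow>\<^sub>0 'k)" where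
  "cone m c = (\<Sum>\<sigma>\<in>Poly_Mapping.keys c.
     if m \<in> \<sigma> then 0 else Poly_Mapping.single (insert m \<sigma>) (Poly_Mapping.lookup c \<sigma>))"

lemma cone_superset:
  assumes "finite S" "Poly_Mapping.keys c \<subseteq> S"
  shows "cone m c = (\<Sum>\<sigma>\<in>S. if m \<in> \<sigma> then 0 else Poly_Mapping.single (insert m \<sigma>) (Poly_Mapping.lookup c \<sigma>))"
  unfolding cone_def by (rule sum.mono_neutral_left) (use assms in \<open>auto simp: in_keys_iff\<close>)

lemma cone_0 [simp]: "cone m 0 = 0"
  by (simp add: cone_def)

lemma cone_add: "cone m (a + b) = cone m a + cone m b"
proof -
  let ?S = "Poly_Mapping.keys a \<union> Poly_Mapping.keys b"
  have f: "finite ?S" by simp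
  have "Poly_Mapping.keys (a + b) \<subseteq> ?S" by (rule keys_add)
  then have "cone m (a + b) = (\<Sum>\<sigma>\<in>?S. (if m \<in> \<sigma> then 0 else Poly_Mapping.single (insert m \<sigma>) (Poly_Mapping.lookup a \<sigma>))
      + (if m \<in> \<sigma> then 0 else Poly_Mapping.single (insert m \<sigma>) (Poly_Mapping.lookup b \<sigma>)))"
    unfolding cone_superset[OF f \<open>Poly_Mapping.keys (a + b) \<subseteq> ?S\<close>]
    by (intro sum.cong) (simp_all add: lookup_add single_add)
  then show ?thesis
    by (simp only: sum.distrib cone_superset[OF f Un_upper1] cone_superset[OF f Un_upper2])
qed

lemma cone_sum: "cone m (\<Sum>i\<in>I. f i) = (\<Sum>i\<in>I. cone m (f i))"
  by (induction I rule: infinite_finite_induct) (auto simp: cone_add)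

lemma cone_single:
  "cone m (Poly_Mapping.single \<sigma> c) = (if m \<in> \<sigma> then 0 else Poly_Mapping.single (insert m \<sigma>) c)"
proof -
  have "Poly_Mapping.keys (Poly_Mapping.single \<sigma> c) \<subseteq> {\<sigma>}" by simp
  then show ?thesis by (subst cone_superset[of "{\<sigma>}"]) simp_all
qed

text \<open>Positive dimension matters: vertices have boundary 0 here, so for a vertex
  \<open>v\<close> other than \<open>m\<close> the left side would be \<open>v - m\<close>.\<close>

lemma cone_homotopy_single:
  assumes min: "\<forall>u\<in>\<sigma>. (m, u) \<in> vertex_order" and fin: "finite \<sigma>" and card: "2 \<le> card \<sigma>"
  shows "chain_boundary (cone m (Poly_Mapping.single \<sigma> c)) + cone m (chain_boundary (Poly_Mapping.single \<sigma> c))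
    = Poly_Mapping.single \<sigma> c"
proof (cases "m \<in> \<sigma>")
  case False
  have ne: "\<sigma> \<noteq> {v}" for v using card by auto
  have "\<sigma> \<noteq> {}" using card by auto
  then have ne': "insert m \<sigma> \<noteq> {v}" for v using False by blast
  have set1: "{v \<in> insert m \<sigma>. insert m \<sigma> \<noteq> {v}} = insert m \<sigma>" using ne' by blast
  have set2: "{v \<in> \<sigma>. \<sigma> \<noteq> {v}} = \<sigma>" using ne by blast
  have "chain_boundary (cone m (Poly_Mapping.single \<sigma> c))
      = Poly_Mapping.single \<sigma> c + (\<Sum>v\<in>\<sigma>. Poly_Mapping.single (insert m \<sigma> - {v}) ((-1) ^ vertex_index (insert m \<sigma>) v * c))"
    using False fin unfolding cone_single if_not_P[OF False] chain_boundary_single set1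
    by (simp add: vertex_index_insert_minimum(1)[OF min False fin])
  also have "(\<Sum>v\<in>\<sigma>. Poly_Mapping.single (insert m \<sigma> - {v}) ((-1) ^ vertex_index (insert m \<sigma>) v * c))
      = (\<Sum>v\<in>\<sigma>. - Poly_Mapping.single (insert m (\<sigma> - {v})) ((-1) ^ vertex_index \<sigma> v * c))"
  proof (rule sum.cong[OF refl])
    fix v assume "v \<in> \<sigma>"
    then have "insert m \<sigma> - {v} = insert m (\<sigma> - {v})" using False by auto
    then show "Poly_Mapping.single (insert m \<sigma> - {v}) ((-1) ^ vertex_index (insert m \<sigma>) v * c)
      = - Poly_Mapping.single (insert m (\<sigma> - {v})) ((-1) ^ vertex_index \<sigma> v * c)"
      by (simp add: vertex_index_insert_minimum(2)[OF min False fin \<open>v \<in> \<sigma>\<close>] single_uminus)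
  qed
  also have "\<dots> = - cone m (chain_boundary (Poly_Mapping.single \<sigma> c))"
    unfolding chain_boundary_single set2 cone_sum cone_single using False by (simp add: sum_negf)
  finally show ?thesis by simp
next
  \<comment> \<open>The cone kills \<sigma> and each face still containing \<open>m\<close>; only
    the face opposite \<open>m\<close> survives, and its cone is \<sigma> again.\<close>
  case True
  define \<tau> where "\<tau> = \<sigma> - {m}"
  have \<tau>: "\<sigma> = insert m \<tau>" "m \<notin> \<tau>" "finite \<tau>" "\<forall>u\<in>\<tau>. (m, u) \<in> vertex_order"
    using True fin min by (auto simp: \<tau>_def)
  have "\<sigma> \<noteq> {v}" for v using card by auto
  then have set: "{v \<in> \<sigma>. \<sigma> \<noteq> {v}} = insert m \<tau>" using \<tau>(1) by blast
  have "cone m (chain_boundary (Poly_Mapping.single \<sigma> c))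
     = (\<Sum>v\<in>insert m \<tau>. if v = m then Poly_Mapping.single \<sigma> c else 0)"
    unfolding chain_boundary_single set cone_sum cone_single
    by (rule sum.cong[OF refl])
      (use \<tau> in \<open>auto simp: vertex_index_insert_minimum(1)[OF \<tau>(4,2,3)]\<close>)
  also have "\<dots> = Poly_Mapping.single \<sigma> c" using \<tau>(3) by simp
  finally show ?thesis by (simp add: cone_single True)
qed

text \<open>By the homotopy identity a cycle is the boundary of its own cone from the least
  vertex.\<close>

lemma full_simplex_acyclic:
  assumes V: "finite V" "V \<noteq> {}" and k: "0 < k" and z: "z \<in> cycles k {\<sigma>. \<sigma> \<subseteq> V \<and> \<sigma> \<noteq> {}}"
  shows "z \<in> boundaries k {\<sigma>. \<sigma> \<subseteq> V \<and> \<sigma> \<noteq> {}}"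
proof -
  obtain m where m: "m \<in> V" "\<forall>u\<in>V. (m, u) \<in> vertex_order"
    using ex_vertex_order_minimum[OF V] by blast
  have keys: "\<sigma> \<subseteq> V" "card \<sigma> = Suc k" if "\<sigma> \<in> Poly_Mapping.keys z" for \<sigma>
    using z that by (auto simp: cycles_def chains_def simplices_def)
  have z_sum: "z = (\<Sum>\<sigma>\<in>Poly_Mapping.keys z. Poly_Mapping.single \<sigma> (Poly_Mapping.lookup z \<sigma>))"
    by (rule sum_single_lookup) simp_all
  let ?g = "\<lambda>\<sigma>. Poly_Mapping.single \<sigma> (Poly_Mapping.lookup z \<sigma>)"
  have "chain_boundary (cone m (\<Sum>\<sigma>\<in>Poly_Mapping.keys z. ?g \<sigma>)) + cone m (chain_boundary (\<Sum>\<sigma>\<in>Poly_Mapping.keys z. ?g \<sigma>))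
     = (\<Sum>\<sigma>\<in>Poly_Mapping.keys z. chain_boundary (cone m (?g \<sigma>)) + cone m (chain_boundary (?g \<sigma>)))"
    by (simp only: cone_sum chain_boundary_sum sum.distrib)
  also have "\<dots> = (\<Sum>\<sigma>\<in>Poly_Mapping.keys z. ?g \<sigma>)"
  proof (intro sum.cong refl cone_homotopy_single)
    fix \<sigma> assume "\<sigma> \<in> Poly_Mapping.keys z"
    note s = keys[OF this]
    show "\<forall>u\<in>\<sigma>. (m, u) \<in> vertex_order" "finite \<sigma>" "2 \<le> card \<sigma>"
      using s m(2) k by (auto simp: finite_subset[OF s(1) V(1)])
  qed
  finally have "chain_boundary (cone m z) + cone m (chain_boundary z) = z"
    unfolding z_sum[symmetric] .
  then have eq: "z = chain_boundary (cone m z)" using z by (simp add: cycles_def)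
  have "cone m z \<in> chains (Suc k) {\<sigma>. \<sigma> \<subseteq> V \<and> \<sigma> \<noteq> {}}"
    unfolding cone_def
  proof (rule chains_sum)
    fix \<sigma> assume "\<sigma> \<in> Poly_Mapping.keys z"
    note s = keys[OF this]
    have "finite \<sigma>" using s(1) V(1) by (rule finite_subset)
    then show "(if m \<in> \<sigma> then 0 else Poly_Mapping.single (insert m \<sigma>) (Poly_Mapping.lookup z \<sigma>))
        \<in> chains (Suc k) {\<sigma>. \<sigma> \<subseteq> V \<and> \<sigma> \<noteq> {}}"
      using s m(1) by (auto simp: chains_def simplices_def)
  qed
  then show ?thesis unfolding boundaries_def using eq by (rule image_eqI[rotated])
qed


section \<open>A cycle graph filled in by a full simplex\<close>

text \<open>The edge from \<open>a\<close> to \<open>b\<close> as a chain. The sign compensates for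
  \<open>vertex_order\<close>, so that the boundary is \<open>b - a\<close> whichever endpoint is
  smaller.\<close>

definition oriented_edge :: "'a \<Rightarrow> 'a \<Rightarrow> ('a set \<Rightarrow>\<^sub>0 'k::field)" where
  "oriented_edge a b = Poly_Mapping.single {a, b} (if (a, b) \<in> vertex_order then 1 else - 1)"

lemma chain_boundary_oriented_edge:
  assumes "a \<noteq> b"
  shows "chain_boundary (oriented_edge a b) = Poly_Mapping.single {b} 1 - Poly_Mapping.single {a} 1"
proof -
  have lin: "total_on UNIV (vertex_order :: 'a rel)" "antisym (vertex_order :: 'a rel)"
    using linear_order_vertex_order[where 'a='a] by (auto simp: order_on_defs)
  have set: "{v \<in> {a, b}. {a, b} \<noteq> {v}} = {a, b}" using assms by auto
  have diff: "{a, b} - {a} = {b}" "{a, b} - {b} = {a}" using assms by auto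
  have index: "vertex_index {u, w} w = (if (u, w) \<in> vertex_order then 1 else 0)" if "u \<noteq> w" for u w :: 'a
  proof -
    have "{x \<in> {u, w}. x \<noteq> w \<and> (x, w) \<in> vertex_order} = (if (u, w) \<in> vertex_order then {u} else {})"
      using that by auto
    then show ?thesis by (simp add: vertex_index_def)
  qed
  have index': "vertex_index {a, b} a = (if (a, b) \<in> vertex_order then 0 else 1)"
  proof -
    have "(b, a) \<in> vertex_order \<longleftrightarrow> (a, b) \<notin> vertex_order"
      using assms lin by (metis UNIV_I antisymD total_on_def)
    then show ?thesis using index[of b a] assms by (simp add: insert_commute)
  qed
  show ?thesis
    unfolding oriented_edge_def chain_boundary_single set
    using assms by (simp add: diff index index' single_uminus)
qed

lemma oriented_edge_chains:
  assumes "{a, b} \<in> K" "a \<noteq> b"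
  shows "oriented_edge a b \<in> chains (Suc 0) K"
  using assms by (auto simp: oriented_edge_def chains_def simplices_def)

lemma single_mem_chains_0: "{a} \<in> K \<Longrightarrow> Poly_Mapping.single {a} c \<in> chains 0 K"
  by (auto simp: chains_def simplices_def)

lemma cycles_0: "cycles 0 K = chains 0 K"
proof -
  have "chain_boundary c = 0" if c: "c \<in> chains 0 K" for c :: "'a set \<Rightarrow>\<^sub>0 'b"
    unfolding chain_boundary_def
  proof (rule sum.neutral, rule ballI, rule sum.neutral, rule ballI)
    fix \<sigma> v assume s: "\<sigma> \<in> Poly_Mapping.keys c" and v: "v \<in> {v \<in> \<sigma>. \<sigma> \<noteq> {v}}"
    have "card \<sigma> = 1" using s c by (auto simp: chains_def simplices_def)
    then have False using v by (auto simp: card_1_singleton_iff)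
    then show "Poly_Mapping.single (\<sigma> - {v}) ((-1) ^ vertex_index \<sigma> v * Poly_Mapping.lookup c \<sigma>) = 0" ..
  qed
  then show ?thesis by (auto simp: cycles_def)
qed

text \<open>The combinatorial content of the geometry. The convention \<open>v n = v 0\<close> lets
  the closing edge be written like the others, \<open>3 \<le> n\<close> keeps the edges distinct,
  and the strict bound by \<open>t\<close> keeps the bar of the loop nonempty.\<close>

locale cycle_filtration =
  fixes n :: nat and v :: "nat \<Rightarrow> 'a" and h :: "nat \<Rightarrow> real" and t :: real
    and K :: "real \<Rightarrow> 'a set set"
  assumes n: "3 \<le> n" and inj: "inj_on v {..<n}" and periodic: "v n = v 0"
    and h_pos: "\<And>j. j < n \<Longrightarrow> 0 < h j"
    and h_le_last: "\<And>j. j < n \<Longrightarrow> h j \<le> h (n - 1)"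
    and h_less: "\<And>j. j < n \<Longrightarrow> h j < t"
    and K_below: "\<And>\<epsilon>. 0 \<le> \<epsilon> \<Longrightarrow> \<epsilon> < t \<Longrightarrow>
      K \<epsilon> = {{v j} |j. j < n} \<union> {{v j, v (Suc j)} |j. j < n \<and> h j \<le> \<epsilon>}"
    and K_above: "\<And>\<epsilon>. t \<le> \<epsilon> \<Longrightarrow> K \<epsilon> = {\<sigma>. \<sigma> \<subseteq> v ` {..<n} \<and> \<sigma> \<noteq> {}}"
begin

text \<open>Brings the successor index back below \<open>n\<close>, where injectivity
  applies.\<close>

lemma v_Suc: "i < n \<Longrightarrow> v (Suc i) = v (if Suc i = n then 0 else Suc i)"
  using periodic by auto

lemma v_eq_iff: "i < n \<Longrightarrow> j < n \<Longrightarrow> v i = v j \<longleftrightarrow> i = j"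
  using inj by (auto simp: inj_on_def)

lemma v_Suc_neq: "i < n \<Longrightarrow> v i \<noteq> v (Suc i)"
  using n by (auto simp: v_Suc v_eq_iff)

lemma edge_eq_iff:
  assumes "i < n" "j < n"
  shows "{v i, v (Suc i)} = {v j, v (Suc j)} \<longleftrightarrow> i = j"
proof -
  define s where "s i = (if Suc i = n then 0 else Suc i)" for i
  have s: "v (Suc i) = v (s i)" "s i < n" if "i < n" for i
    using that periodic by (auto simp: s_def)
  \<comment> \<open>With \<open>s\<close> the cyclic successor, two edges agree crosswise only if
    \<open>s\<close> exchanges their indices, which happens on a cycle of length 2 but not for
    \<open>3 \<le> n\<close>.\<close>
  have "\<not> (i = s j \<and> s i = j)" using n by (auto simp: s_def)
  then show ?thesis
    using assms s(2) by (auto simp: s(1) doubleton_eq_iff v_eq_iff)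
qed

lemma v_mem: "0 \<le> \<epsilon> \<Longrightarrow> j < n \<Longrightarrow> {v j} \<in> K \<epsilon>"
  by (cases "\<epsilon> < t") (auto simp: K_below K_above)

lemma edge_mem_iff:
  assumes "0 \<le> \<epsilon>" "j < n"
  shows "{v j, v (Suc j)} \<in> K \<epsilon> \<longleftrightarrow> h j \<le> \<epsilon>"
proof (cases "\<epsilon> < t")
  case True
  show ?thesis
  proof
    assume "{v j, v (Suc j)} \<in> K \<epsilon>"
    then consider i where "{v j, v (Suc j)} = {v i}" | i where "{v j, v (Suc j)} = {v i, v (Suc i)}" "i < n" "h i \<le> \<epsilon>"
      unfolding K_below[OF assms(1) True] by blast
    then show "h j \<le> \<epsilon>"
    proof cases
      case 1 then show ?thesis using v_Suc_neq[OF assms(2)] by (metis doubleton_eq_iff insert_absorb2)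
    next
      case 2 then show ?thesis using edge_eq_iff[OF assms(2) 2(2)] by simp
    qed
  next
    assume "h j \<le> \<epsilon>"
    then show "{v j, v (Suc j)} \<in> K \<epsilon>"
      unfolding K_below[OF assms(1) True] using assms(2) by blast
  qed
next
  case False
  have "v (Suc j) \<in> v ` {..<n}" using v_Suc[OF assms(2)] assms(2) by auto
  moreover have "v j \<in> v ` {..<n}" using assms(2) by simp
  ultimately show ?thesis using False h_less[OF assms(2)] by (simp add: K_above)
qed

lemma K_mono:
  assumes "0 \<le> \<epsilon>" "\<epsilon> \<le> \<delta>"
  shows "K \<epsilon> \<subseteq> K \<delta>"
proof
  fix \<sigma> assume s: "\<sigma> \<in> K \<epsilon>"
  show "\<sigma> \<in> K \<delta>"
  proof (cases "\<epsilon> < t")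
    case True
    then consider j where "\<sigma> = {v j}" "j < n" | j where "\<sigma> = {v j, v (Suc j)}" "j < n" "h j \<le> \<epsilon>"
      using s K_below[OF assms(1) True] by blast
    then show ?thesis
    proof cases
      case 1 then show ?thesis using v_mem[of \<delta> j] assms by simp
    next
      case 2 then show ?thesis using edge_mem_iff[of \<delta> j] assms by simp
    qed
  next
    case False
    then show ?thesis using s K_above[of \<epsilon>] K_above[of \<delta>] assms by simp
  qed
qed

section \<open>Simplices and chains by dimension\<close>

lemma simplices_0:
  assumes "0 \<le> \<epsilon>" "\<sigma> \<in> simplices 0 (K \<epsilon>)"
  shows "\<exists>j<n. \<sigma> = {v j}"
proof -
  obtain x where x: "\<sigma> = {x}" "{x} \<in> K \<epsilon>"
    using assms(2) by (auto simp: simplices_def card_1_singleton_iff)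
  show ?thesis
  proof (cases "\<epsilon> < t")
    case True
    then consider j where "{x} = {v j}" "j < n" | j where "{x} = {v j, v (Suc j)}" "j < n"
      using x(2) K_below[OF assms(1) True] by blast
    then show ?thesis
    proof cases
      case 1 then show ?thesis using x(1) by blast
    next
      case 2 then show ?thesis using v_Suc_neq[of j] by (metis doubleton_eq_iff insert_absorb2)
    qed
  next
    case False
    then show ?thesis using x by (auto simp: K_above)
  qed
qed

lemma simplices_1_below:
  assumes "0 \<le> \<epsilon>" "\<epsilon> < t"
  shows "\<sigma> \<in> simplices (Suc 0) (K \<epsilon>) \<longleftrightarrow> (\<exists>j<n. h j \<le> \<epsilon> \<and> \<sigma> = {v j, v (Suc j)})"
  using v_Suc_neq by (auto simp: simplices_def K_below[OF assms])

lemma simplices_2_below: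
  assumes "0 \<le> \<epsilon>" "\<epsilon> < t" "2 \<le> k"
  shows "simplices k (K \<epsilon>) = {}"
  using v_Suc_neq assms(3) by (auto simp: simplices_def K_below[OF assms(1,2)])

lemma chains_2_below: "0 \<le> \<epsilon> \<Longrightarrow> \<epsilon> < t \<Longrightarrow> 2 \<le> k \<Longrightarrow> chains k (K \<epsilon>) = {0}"
  by (auto simp: chains_def simplices_2_below)

lemma acyclic_above: "t \<le> \<epsilon> \<Longrightarrow> 0 < k \<Longrightarrow> z \<in> cycles k (K \<epsilon>) \<Longrightarrow> z \<in> boundaries k (K \<epsilon>)"
  using n full_simplex_acyclic[of "v ` {..<n}" k z] by (simp add: K_above lessThan_empty_iff)

text \<open>
  Counting the vertices after the \<open>j\<close>-th edge \<open>{v j, v (Suc j)}\<close> is constant on the components of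
  every graph that contains neither this edge nor the last one, which is the longest.
\<close>

definition coord :: "nat \<Rightarrow> ('a set \<Rightarrow>\<^sub>0 'k::field) \<Rightarrow> 'k" where
  "coord j z = (\<Sum>i<n. if j = n - 1 \<or> j < i then Poly_Mapping.lookup z {v i} else 0)"

lemma coord_0 [simp]: "coord j 0 = 0"
  by (auto simp: coord_def intro!: sum.neutral)

lemma coord_add: "coord j (z + w) = coord j z + coord j w"
  unfolding coord_def sum.distrib[symmetric] by (rule sum.cong) (auto simp: lookup_add)

lemma coord_scale: "coord j (chain_scale r z) = r * coord j z"
  by (auto simp: coord_def sum_distrib_left intro!: sum.cong)

lemma coord_diff: "coord j (z - w) = coord j z - coord j w"
  using coord_add[of j "z - w" w] by simp

lemma coord_sum: "coord j (\<Sum>i\<in>I. f i) = (\<Sum>i\<in>I. coord j (f i))"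
  by (induction I rule: infinite_finite_induct) (auto simp: coord_add)

lemma coord_single:
  assumes "k < n"
  shows "coord j (Poly_Mapping.single {v k} c) = (if j = n - 1 \<or> j < k then c else 0)"
proof -
  have "coord j (Poly_Mapping.single {v k} c) = (\<Sum>i<n. if i = k then (if j = n - 1 \<or> j < k then c else 0) else 0)"
    unfolding coord_def
    using assms by (intro sum.cong) (auto simp: lookup_single when_def v_eq_iff)
  also have "\<dots> = (if j = n - 1 \<or> j < k then c else 0)"
    using assms by (subst sum.delta) auto
  finally show ?thesis .
qed

text \<open>The first \<open>n - 1\<close> coordinates are dual to the path edges: edge
  \<open>i\<close> enters the counted tail exactly for \<open>j = i\<close>. The closing edge
  returns to \<open>v 0\<close> and so leaves every such tail, which gives -1. The last coordinate
  is the augmentation, zero on any boundary of an edge.\<close>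

lemma coord_boundary_edge:
  assumes "i < n" "j < n"
  shows "coord j (chain_boundary (oriented_edge (v i) (v (Suc i)))) =
    (if j = n - 1 then 0 else if i = n - 1 then - 1 else if i = j then 1 else 0)"
proof -
  have "coord j (Poly_Mapping.single {v (Suc i)} 1)
      = (if j = n - 1 \<or> j < (if Suc i = n then 0 else Suc i) then 1 else 0)"
    using assms(1) by (subst v_Suc[OF assms(1)], subst coord_single) auto
  then show ?thesis
    using assms by (auto simp: chain_boundary_oriented_edge[OF v_Suc_neq] coord_diff coord_single)
qed

text \<open>The coordinates are the tail sums of the coefficients, and each coefficient is the
  difference of two consecutive tail sums.\<close>

lemma coord_eq_0D:
  assumes "0 \<le> \<epsilon>" and z: "z \<in> chains 0 (K \<epsilon>)" and coord: "\<And>j. j < n \<Longrightarrow> coord j z = 0"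
  shows "z = 0"
proof (rule poly_mapping_eqI)
  fix \<sigma>
  \<comment> \<open>\<open>T k\<close> is the augmentation \<open>coord (n - 1)\<close> for
    \<open>k = 0\<close>, it is \<open>coord (k - 1)\<close> for \<open>k\<close> strictly between 0
    and \<open>n\<close>, and it is an empty sum for \<open>k = n\<close>.\<close>
  define T where "T k = (\<Sum>i\<in>{k..<n}. Poly_Mapping.lookup z {v i})" for k
  have T0: "T k = 0" if kn: "k \<le> n" for k
  proof -
    consider "k = n" | "k = 0" | "k = Suc (k - 1)" "k - 1 < n - 1" using kn by linarith
    then show ?thesis
    proof cases
      case 1 then show ?thesis by (simp add: T_def)
    next
      case 2 then show ?thesis
        using coord[of "n - 1"] n by (simp add: T_def coord_def atLeast0LessThan)
    next
      case 3
      define j where "j = k - 1"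
      have j: "k = Suc j" "j < n - 1" using 3 by (simp_all add: j_def)
      have "coord j z = (\<Sum>i\<in>{i\<in>{..<n}. j < i}. Poly_Mapping.lookup z {v i})"
        unfolding coord_def using j(2) by (subst sum.inter_filter) auto
      also have "{i\<in>{..<n}. j < i} = {k..<n}" using j(1) by auto
      finally show ?thesis using coord[of j] j(2) by (simp add: T_def)
    qed
  qed
  have "Poly_Mapping.lookup z {v i} = 0" if "i < n" for i
    using T0[of i] T0[of "Suc i"] that by (simp add: T_def sum.atLeast_Suc_lessThan[OF that])
  then show "Poly_Mapping.lookup z \<sigma> = Poly_Mapping.lookup 0 \<sigma>"
    using z assms(1) by (cases "\<sigma> \<in> Poly_Mapping.keys z")
      (auto simp: chains_def in_keys_iff dest!: subsetD[of _ "simplices 0 (K \<epsilon>)"] simplices_0)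
qed

text \<open>If the \<open>j\<close>-th edge is still absent below \<open>t\<close>, so is the
  closing edge, being at least as long; no edge that is present then changes the count. From
  \<open>t\<close> on arbitrary pairs of vertices are edges, but every \<open>h j\<close> is passed,
  so \<open>j = n - 1\<close> and the functional is the augmentation.\<close>

lemma coord_boundary:
  fixes b :: "'a set \<Rightarrow>\<^sub>0 'k::field"
  assumes "0 \<le> \<epsilon>" "b \<in> boundaries 0 (K \<epsilon>)" "j < n" "j = n - 1 \<or> \<epsilon> < h j"
  shows "coord j b = 0"
proof -
  obtain c where c: "b = chain_boundary c" "c \<in> chains (Suc 0) (K \<epsilon>)"
    using assms(2) by (auto simp: boundaries_def)
  have zero: "coord j (chain_boundary (Poly_Mapping.single \<sigma> x)) = 0" if s: "\<sigma> \<in> simplices (Suc 0) (K \<epsilon>)" for \<sigma> and x :: 'k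
  proof -
    have "\<exists>a b. a \<noteq> b \<and> \<sigma> = {a, b} \<and> coord j (chain_boundary (oriented_edge a b :: _ \<Rightarrow>\<^sub>0 'k)) = 0"
    proof (cases "\<epsilon> < t")
      case True
      then obtain i where i: "i < n" "h i \<le> \<epsilon>" "\<sigma> = {v i, v (Suc i)}"
        using s simplices_1_below[OF assms(1) True] by blast
      have "coord j (chain_boundary (oriented_edge (v i) (v (Suc i)) :: _ \<Rightarrow>\<^sub>0 'k)) = 0"
        using assms(3,4) i(1,2) h_le_last[of j] by (auto simp: coord_boundary_edge)
      with i(3) v_Suc_neq[OF i(1)] show ?thesis
        by (intro exI[of _ "v i"] exI[of _ "v (Suc i)"] conjI)
    next
      case False
      then have "j = n - 1" using assms(3,4) h_less[of j] by auto
      have sub: "\<sigma> \<subseteq> v ` {..<n}" and "card \<sigma> = 2"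
        using s False by (simp_all add: simplices_def K_above)
      then obtain a b where ab: "\<sigma> = {a, b}" "a \<noteq> b" by (auto simp: card_2_iff)
      with sub have "a \<in> v ` {..<n}" "b \<in> v ` {..<n}" by simp_all
      then obtain i l where "i < n" "a = v i" "l < n" "b = v l" by blast
      then have "coord j (Poly_Mapping.single {a} 1) = (1 :: 'k)" "coord j (Poly_Mapping.single {b} 1) = (1 :: 'k)"
        using \<open>j = n - 1\<close> by (simp_all add: coord_single)
      then have "coord j (chain_boundary (oriented_edge a b :: _ \<Rightarrow>\<^sub>0 'k)) = 0"
        unfolding chain_boundary_oriented_edge[OF ab(2)] coord_diff by simp
      with ab(1,2) show ?thesis by (intro exI[of _ a] exI[of _ b] conjI)
    qed
    then obtain a b where ab: "a \<noteq> b" "\<sigma> = {a, b}" "coord j (chain_boundary (oriented_edge a b :: _ \<Rightarrow>\<^sub>0 'k)) = 0"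
      by blast
    have "Poly_Mapping.single \<sigma> x = chain_scale (if (a, b) \<in> vertex_order then x else - x) (oriented_edge a b)"
      by (simp add: oriented_edge_def chain_scale_single ab(2))
    then show ?thesis by (simp only: chain_boundary_scale coord_scale ab(3) mult_zero_right)
  qed
  have "coord j b = (\<Sum>\<sigma>\<in>Poly_Mapping.keys c. coord j (chain_boundary (Poly_Mapping.single \<sigma> (Poly_Mapping.lookup c \<sigma>))))"
    unfolding c(1) coord_sum[symmetric]
    by (rule arg_cong[where f = "coord j"], rule chain_boundary_eq_sum) simp_all
  also have "\<dots> = 0"
    using c(2) by (intro sum.neutral ballI zero) (auto simp: chains_def)
  finally show ?thesis .
qed

text \<open>Duality with the path edges: this serves both to fill a chain whose coordinates vanish
  on the living bars and to realise prescribed coordinates.\<close>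

lemma sum_edge_coord:
  assumes "i < n"
  shows "coord i (\<Sum>j<n-1. chain_scale (x j) (chain_boundary (oriented_edge (v j) (v (Suc j)))))
    = (if i = n - 1 then 0 else x i)"
proof -
  have "coord i (\<Sum>j<n-1. chain_scale (x j) (chain_boundary (oriented_edge (v j) (v (Suc j)))))
    = (\<Sum>j<n-1. if j = i then x i else 0)"
    unfolding coord_sum coord_scale
    using assms by (intro sum.cong) (auto simp: coord_boundary_edge)
  also have "\<dots> = (if i = n - 1 then 0 else x i)" using assms by auto
  finally show ?thesis .
qed

text \<open>All vertices are present from scale 0 on, so the boundary is a chain even before the
  edge itself appears.\<close>

lemma boundary_edge_mem_chains:
  assumes "0 \<le> \<epsilon>" "i < n"
  shows "chain_boundary (oriented_edge (v i) (v (Suc i))) \<in> chains 0 (K \<epsilon>)"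
proof -
  have "{v (Suc i)} \<in> K \<epsilon>"
    unfolding v_Suc[OF assms(2)] by (rule v_mem[OF assms(1)]) (use assms(2) n in auto)
  then show ?thesis
    unfolding chain_boundary_oriented_edge[OF v_Suc_neq[OF assms(2)]]
    by (intro chains_diff single_mem_chains_0 v_mem[OF assms])
qed

text \<open>The closing edge merges no components, so its index is free to carry the essential
  class.\<close>

definition bars0 :: "bar list" where
  "bars0 = map (\<lambda>j. (0, if j = n - 1 then \<infinity> else ereal (h j))) [0..<n]"

lemma in_bars0:
  assumes "0 \<le> \<epsilon>" "j < n"
  shows "in_bar \<epsilon> (bars0 ! j) \<longleftrightarrow> j = n - 1 \<or> \<epsilon> < h j"
  using assms by (simp add: bars0_def in_bar_def)

lemma has_barcode_0:
  "has_barcode (persistent_homology 0 K :: ('k::field, ('a set \<Rightarrow>\<^sub>0 'k) set) pmodule) bars0"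
proof (rule has_barcode_persistent_homologyI[where \<psi> = coord])
  have len: "length bars0 = n" by (simp add: bars0_def)
  fix a b assume "(a, b) \<in> set bars0"
  then show "0 \<le> a \<and> ereal a < b" using h_pos by (auto simp: bars0_def)
next
  fix \<epsilon> \<delta> :: real assume "0 \<le> \<epsilon>" "\<epsilon> \<le> \<delta>"
  then show "K \<epsilon> \<subseteq> K \<delta>" by (rule K_mono)
next
  fix i \<epsilon> and z :: "'a set \<Rightarrow>\<^sub>0 'k"
  assume "i < length bars0" "0 \<le> \<epsilon>" "\<epsilon> < fst (bars0 ! i)"
  then show "coord i z = 0" by (simp add: bars0_def)
next
  fix \<epsilon> :: real and z :: "'a set \<Rightarrow>\<^sub>0 'k"
  assume e: "0 \<le> \<epsilon>" and z: "z \<in> cycles 0 (K \<epsilon>)"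
  have len: "length bars0 = n" by (simp add: bars0_def)
  show "z \<in> boundaries 0 (K \<epsilon>) \<longleftrightarrow> (\<forall>i<length bars0. in_bar \<epsilon> (bars0 ! i) \<longrightarrow> coord i z = 0)"
  proof
    assume "z \<in> boundaries 0 (K \<epsilon>)"
    from coord_boundary[OF e this] show "\<forall>i<length bars0. in_bar \<epsilon> (bars0 ! i) \<longrightarrow> coord i z = 0"
      by (auto simp: len in_bars0[OF e])
  next
    assume a: "\<forall>i<length bars0. in_bar \<epsilon> (bars0 ! i) \<longrightarrow> coord i z = 0"
    have zero: "coord i z = 0" if "i < n" "i = n - 1 \<or> \<epsilon> < h i" for i
      using a[rule_format, of i] that by (simp add: len in_bars0[OF e])
    \<comment> \<open>Duality forces these coefficients. They vanish on the edges not yet present,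
      whose bars are alive, so \<open>c\<close> is a chain at scale \<epsilon>; subtracting its
      boundary from \<open>z\<close> leaves a chain with all coordinates zero.\<close>
    define c where "c = (\<Sum>j<n-1. chain_scale (coord j z) (oriented_edge (v j) (v (Suc j))))"
    have c: "c \<in> chains (Suc 0) (K \<epsilon>)"
      unfolding c_def
    proof (rule chains_sum)
      fix j assume "j \<in> {..<n-1}"
      then have j: "j < n" by simp
      show "chain_scale (coord j z) (oriented_edge (v j) (v (Suc j))) \<in> chains (Suc 0) (K \<epsilon>)"
      proof (cases "\<epsilon> < h j")
        case True
        have "chain_scale 0 w = 0" for w :: "'a set \<Rightarrow>\<^sub>0 'k" by (rule poly_mapping_eqI) simp
        then show ?thesis using zero[OF j] True by simp
      next
        case False
        then show ?thesis
          using edge_mem_iff[OF e j] v_Suc_neq[OF j] by (intro chains_scale oriented_edge_chains) auto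
      qed
    qed
    have bc: "chain_boundary c = (\<Sum>j<n-1. chain_scale (coord j z) (chain_boundary (oriented_edge (v j) (v (Suc j)))))"
      unfolding c_def chain_boundary_sum chain_boundary_scale ..
    have "z - chain_boundary c = 0"
    proof (rule coord_eq_0D[OF e])
      show "z - chain_boundary c \<in> chains 0 (K \<epsilon>)"
        using z unfolding bc cycles_0
        by (intro chains_diff chains_sum chains_scale boundary_edge_mem_chains e) auto
      show "coord j (z - chain_boundary c) = 0" if "j < n" for j
        using that zero[of j] unfolding bc coord_diff sum_edge_coord[OF that] by auto
    qed
    then show "z \<in> boundaries 0 (K \<epsilon>)" using c by (auto simp: boundaries_def)
  qed
next
  fix \<epsilon> :: real and x :: "nat \<Rightarrow> 'k"
  assume e: "0 \<le> \<epsilon>"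
  have len: "length bars0 = n" by (simp add: bars0_def)
  \<comment> \<open>The vertex \<open>v 0\<close> lies in no proper tail, so it adjusts the
    augmentation without disturbing the other coordinates.\<close>
  define z where "z = (\<Sum>j<n-1. chain_scale (x j) (chain_boundary (oriented_edge (v j) (v (Suc j)))))
     + Poly_Mapping.single {v 0} (x (n - 1))"
  have "z \<in> cycles 0 (K \<epsilon>)"
    unfolding z_def cycles_0 using n
    by (intro chains_add chains_sum chains_scale boundary_edge_mem_chains single_mem_chains_0 v_mem e) auto
  moreover have "coord i z = x i" if "i < n" for i
    using that n coord_single[of 0 i "x (n - 1)"] unfolding z_def coord_add sum_edge_coord[OF that] by auto
  ultimately show "\<exists>z\<in>cycles 0 (K \<epsilon>). \<forall>i<length bars0. in_bar \<epsilon> (bars0 ! i) \<longrightarrow> coord i z = x i"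
    by (auto simp: len)
qed (simp_all add: coord_add coord_scale)

text \<open>Without the closing edge the support lies in a path, which carries no cycle:
  \<open>coord i\<close> of the boundary isolates the coefficient of the \<open>i\<close>-th edge up
  to sign.\<close>

lemma cycle_below_eq_0:
  assumes "0 \<le> \<epsilon>" "\<epsilon> < t" and z: "z \<in> cycles (Suc 0) (K \<epsilon>)"
    and last: "Poly_Mapping.lookup z {v (n - 1), v n} = 0"
  shows "z = 0"
proof -
  let ?e = "\<lambda>j. {v j, v (Suc j)}"
  have last': "Poly_Mapping.lookup z (?e (n - 1)) = 0" using last n by simp
  have inj_e: "inj_on ?e {..<n}" by (auto simp: inj_on_def edge_eq_iff)
  have keys: "Poly_Mapping.keys z \<subseteq> ?e ` {..<n}"
    using z simplices_1_below[OF assms(1,2)] by (auto simp: cycles_def chains_def subset_iff image_iff)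
  have zb: "chain_boundary z = (\<Sum>j<n. chain_boundary (Poly_Mapping.single (?e j) (Poly_Mapping.lookup z (?e j))))"
    by (subst chain_boundary_eq_sum[OF _ keys]) (simp_all only: finite_imageI finite_lessThan sum.reindex[OF inj_e] o_def)
  \<comment> \<open>The coefficients with respect to the oriented edges, in place of the simplices
    oriented by \<open>vertex_order\<close>.\<close>
  define y where "y j = (if (v j, v (Suc j)) \<in> vertex_order then Poly_Mapping.lookup z (?e j) else - Poly_Mapping.lookup z (?e j))" for j
  have single: "Poly_Mapping.single (?e j) (Poly_Mapping.lookup z (?e j)) = chain_scale (y j) (oriented_edge (v j) (v (Suc j)))" for j
    by (simp add: oriented_edge_def chain_scale_single y_def)
  have y0: "y i = 0" if "i < n" for i
  proof (cases "i = n - 1")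
    case True then show ?thesis using last' by (simp add: y_def)
  next
    case False
    have "0 = coord i (chain_boundary z)" using z by (simp add: cycles_def)
    also have "\<dots> = (\<Sum>j<n. if j = i then y i else 0)"
      unfolding zb single coord_sum chain_boundary_scale coord_scale
      using that False last' by (intro sum.cong) (auto simp: coord_boundary_edge y_def)
    also have "\<dots> = y i" using that by simp
    finally show ?thesis by simp
  qed
  show "z = 0"
  proof (rule poly_mapping_eqI)
    fix \<sigma>
    have "Poly_Mapping.lookup z (?e i) = 0" if "i < n" for i
      using y0[OF that] by (simp add: y_def split: if_splits)
    then show "Poly_Mapping.lookup z \<sigma> = Poly_Mapping.lookup 0 \<sigma>"
      using keys by (cases "\<sigma> \<in> Poly_Mapping.keys z") (auto simp: subset_iff image_iff in_keys_iff)
  qed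
qed

text \<open>The coordinate is the coefficient of the closing edge: below \<open>t\<close> it
  determines a cycle, since a cycle on which it vanishes is zero.\<close>

lemma has_barcode_1:
  "has_barcode (persistent_homology (Suc 0) K :: ('k::field, ('a set \<Rightarrow>\<^sub>0 'k) set) pmodule) [(h (n - 1), ereal t)]"
proof (rule has_barcode_persistent_homologyI[where \<psi> = "\<lambda>_ z. Poly_Mapping.lookup z {v (n - 1), v n}"])
  fix a b assume "(a, b) \<in> set [(h (n - 1), ereal t)]"
  then show "0 \<le> a \<and> ereal a < b" using h_pos[of "n - 1"] h_less[of "n - 1"] n by auto
next
  fix \<epsilon> \<delta> :: real assume "0 \<le> \<epsilon>" "\<epsilon> \<le> \<delta>"
  then show "K \<epsilon> \<subseteq> K \<delta>" by (rule K_mono)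
next
  have born: "Poly_Mapping.lookup z {v (n - 1), v n} = 0"
    if "0 \<le> \<epsilon>" "\<epsilon> < h (n - 1)" "z \<in> cycles (Suc 0) (K \<epsilon>)" for \<epsilon> and z :: "'a set \<Rightarrow>\<^sub>0 'k"
  proof -
    have "{v (n - 1), v n} \<notin> K \<epsilon>" using edge_mem_iff[of \<epsilon> "n - 1"] that n by simp
    moreover have "Poly_Mapping.keys z \<subseteq> K \<epsilon>"
      using that(3) unfolding cycles_def chains_def simplices_def by blast
    ultimately show ?thesis by (meson in_keys_iff subsetD)
  qed
  { fix i \<epsilon> and z :: "'a set \<Rightarrow>\<^sub>0 'k"
    assume "i < length [(h (n - 1), ereal t)]" "0 \<le> \<epsilon>" "\<epsilon> < fst ([(h (n - 1), ereal t)] ! i)" "z \<in> cycles (Suc 0) (K \<epsilon>)"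
    then show "Poly_Mapping.lookup z {v (n - 1), v n} = 0" using born by simp
  next
    fix \<epsilon> :: real and z :: "'a set \<Rightarrow>\<^sub>0 'k"
    assume e: "0 \<le> \<epsilon>" and z: "z \<in> cycles (Suc 0) (K \<epsilon>)"
    show "z \<in> boundaries (Suc 0) (K \<epsilon>) \<longleftrightarrow> (\<forall>i<length [(h (n - 1), ereal t)].
        in_bar \<epsilon> ([(h (n - 1), ereal t)] ! i) \<longrightarrow> Poly_Mapping.lookup z {v (n - 1), v n} = 0)"
    proof (cases "\<epsilon> < t")
      case True
      have "chains (Suc (Suc 0)) (K \<epsilon>) = {0 :: 'a set \<Rightarrow>\<^sub>0 'k}"
        by (rule chains_2_below[OF e True]) simp
      then have zero: "boundaries (Suc 0) (K \<epsilon>) = {0 :: 'a set \<Rightarrow>\<^sub>0 'k}"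
        by (simp add: boundaries_def)
      have "z = 0" if "in_bar \<epsilon> (h (n - 1), ereal t) \<longrightarrow> Poly_Mapping.lookup z {v (n - 1), v n} = 0"
      proof (rule cycle_below_eq_0[OF e True z])
        show "Poly_Mapping.lookup z {v (n - 1), v n} = 0"
          using that born[OF e _ z] True by (cases "\<epsilon> < h (n - 1)") (simp_all add: in_bar_def)
      qed
      moreover have "Poly_Mapping.lookup z {v (n - 1), v n} = 0" if "z = 0"
        unfolding that by simp
      ultimately show ?thesis unfolding zero by auto
    next
      case False
      then have "z \<in> boundaries (Suc 0) (K \<epsilon>)" "\<not> in_bar \<epsilon> (h (n - 1), ereal t)"
        using acyclic_above[OF _ _ z] by (simp_all add: in_bar_def)
      then show ?thesis by simp
    qed
  next
    fix \<epsilon> :: real and x :: "nat \<Rightarrow> 'k"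
    assume e: "0 \<le> \<epsilon>"
    show "\<exists>z\<in>cycles (Suc 0) (K \<epsilon>). \<forall>i<length [(h (n - 1), ereal t)].
        in_bar \<epsilon> ([(h (n - 1), ereal t)] ! i) \<longrightarrow> Poly_Mapping.lookup z {v (n - 1), v n} = x i"
    proof (cases "h (n - 1) \<le> \<epsilon>")
      case True
      \<comment> \<open>Once traversed, the cycle has telescoping boundary. All its edges are
        present because the closing one is the longest.\<close>
      define w :: "'a set \<Rightarrow>\<^sub>0 'k" where "w = (\<Sum>j<n. oriented_edge (v j) (v (Suc j)))"
      have "w \<in> chains (Suc 0) (K \<epsilon>)"
        unfolding w_def
      proof (rule chains_sum)
        fix j assume "j \<in> {..<n}"
        then have j: "j < n" by simp
        show "oriented_edge (v j) (v (Suc j)) \<in> chains (Suc 0) (K \<epsilon>)"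
          using edge_mem_iff[OF e j] v_Suc_neq[OF j] h_le_last[OF j] True by (intro oriented_edge_chains) auto
      qed
      moreover have "chain_boundary w = (\<Sum>j<n. Poly_Mapping.single {v (Suc j)} 1 - Poly_Mapping.single {v j} 1)"
        unfolding w_def chain_boundary_sum
        by (rule sum.cong) (auto simp: chain_boundary_oriented_edge[OF v_Suc_neq])
      then have "chain_boundary w = 0"
        unfolding sum_lessThan_telescope[of "\<lambda>j. Poly_Mapping.single {v j} 1"] by (simp add: periodic)
      ultimately have w: "w \<in> cycles (Suc 0) (K \<epsilon>)" by (simp add: cycles_def)
      \<comment> \<open>The coefficient of the closing edge in \<open>w\<close>. It squares to 1, so
        scaling by \<open>x 0 * ?s\<close> gives the coefficient \<open>x 0\<close>.\<close>
      let ?s = "if (v (n - 1), v n) \<in> vertex_order then 1 else - 1 :: 'k"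
      have "Poly_Mapping.lookup w {v (n - 1), v n} = (\<Sum>j<n. if j = n - 1 then ?s else 0)"
        unfolding w_def lookup_sum
      proof (rule sum.cong[OF refl])
        fix j assume "j \<in> {..<n}"
        then have "{v j, v (Suc j)} = {v (n - 1), v n} \<longleftrightarrow> j = n - 1"
          using edge_eq_iff[of j "n - 1"] n by simp
        then show "Poly_Mapping.lookup (oriented_edge (v j) (v (Suc j))) {v (n - 1), v n} = (if j = n - 1 then ?s else 0)"
          using n by (simp add: oriented_edge_def lookup_single when_def)
      qed
      also have "\<dots> = ?s" using n by simp
      finally have "Poly_Mapping.lookup (chain_scale (x 0 * ?s) w) {v (n - 1), v n} = x 0" by simp
      then show ?thesis by (intro bexI[OF _ cycles_scale[OF w, of "x 0 * ?s"]]) simp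
    next
      case False
      have "0 \<in> cycles (Suc 0) (K \<epsilon>)" by (simp add: cycles_def)
      with False show ?thesis by (intro bexI[of _ 0]) (simp_all add: in_bar_def)
    qed }
qed (simp_all add: lookup_add)

section \<open>Higher degrees and the total magnitude\<close>

lemma has_barcode_2:
  assumes "2 \<le> k"
  shows "has_barcode (persistent_homology k K :: ('k::field, ('a set \<Rightarrow>\<^sub>0 'k) set) pmodule) []"
proof (rule has_barcode_persistent_homologyI[where \<psi> = "\<lambda>_ _. 0"])
  fix \<epsilon> :: real and z :: "'a set \<Rightarrow>\<^sub>0 'k"
  assume e: "0 \<le> \<epsilon>" and z: "z \<in> cycles k (K \<epsilon>)"
  have "z \<in> boundaries k (K \<epsilon>)"
  proof (cases "\<epsilon> < t")
    case True
    then have "z = 0" using z chains_2_below[OF e True assms] by (auto simp: cycles_def)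
    then show ?thesis by simp
  next
    case False
    then show ?thesis using acyclic_above[OF _ _ z] assms by simp
  qed
  then show "z \<in> boundaries k (K \<epsilon>) \<longleftrightarrow> (\<forall>i<length []. in_bar \<epsilon> ([] ! i) \<longrightarrow> (0::'k) = 0)" by simp
next
  fix \<epsilon> :: real
  have "(0 :: 'a set \<Rightarrow>\<^sub>0 'k) \<in> cycles k (K \<epsilon>)" by (simp add: cycles_def)
  then show "\<exists>z::'a set \<Rightarrow>\<^sub>0 'k\<in>cycles k (K \<epsilon>). \<forall>i<length []. in_bar \<epsilon> ([] ! i) \<longrightarrow> 0 = x i" for x :: "nat \<Rightarrow> 'k"
    by auto
qed (simp_all add: K_mono)

text \<open>The essential bar contributes 1 and the loop contributes
  \<open>- exp (- h (n - 1)) + exp (- t)\<close>. Together they supply the summand of the closing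
  edge, so all edges look alike, and leave \<open>exp (- t)\<close>.\<close>

lemma has_persistent_magnitude:
  "has_persistent_magnitude TYPE('k::field) K ((\<Sum>j<n. 1 - exp (- h j)) + exp (- t))"
  unfolding has_persistent_magnitude_def
proof (intro exI conjI allI)
  define bs where "bs k = (if k = 0 then bars0 else if k = Suc 0 then [(h (n - 1), ereal t)] else [])" for k
  show "has_barcode (persistent_homology k K :: ('k, ('a set \<Rightarrow>\<^sub>0 'k) set) pmodule) (bs k)" for k
    using has_barcode_0 has_barcode_1 has_barcode_2[of k] by (auto simp: bs_def)
  have "(\<lambda>k. (-1) ^ k * (\<Sum>I\<leftarrow>bs k. bar_magnitude I)) sums
      (\<Sum>k\<in>{0, Suc 0}. (-1) ^ k * (\<Sum>I\<leftarrow>bs k. bar_magnitude I))"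
    by (rule sums_finite) (auto simp: bs_def)
  moreover have "(\<Sum>I\<leftarrow>bars0. bar_magnitude I) = (\<Sum>j<n. 1 - (if j = n - 1 then 0 else exp (- h j)))"
    unfolding bars0_def map_map
    by (subst sum_list_sum_nth) (auto simp: bar_magnitude_def atLeast0LessThan intro!: sum.cong)
  moreover have "\<dots> = (\<Sum>j<n. (1 - exp (- h j)) + (if j = n - 1 then exp (- h (n - 1)) else 0))"
    by (rule sum.cong) auto
  moreover have "\<dots> = (\<Sum>j<n. 1 - exp (- h j)) + exp (- h (n - 1))"
    using n by (simp add: sum.distrib)
  ultimately show "(\<lambda>k. (-1) ^ k * (\<Sum>I\<leftarrow>bs k. bar_magnitude I)) sums ((\<Sum>j<n. 1 - exp (- h j)) + exp (- t))"
    by (simp add: bs_def bar_magnitude_def)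
qed

end


section \<open>Finite subsets of a circle\<close>

text \<open>The radius is a parameter so that witnesses off the circle also have polar form and
  every inner product becomes a single cosine.\<close>

definition circle_point :: "real \<Rightarrow> real \<Rightarrow> real ^ 2" where
  "circle_point r \<theta> = vector [r * cos \<theta>, r * sin \<theta>]"

lemma inner_circle_point: "circle_point r a \<bullet> circle_point s b = r * s * cos (a - b)"
  by (simp add: circle_point_def inner_vec_def sum_2 cos_diff algebra_simps)

lemma norm_circle_point: "norm (circle_point r a) = \<bar>r\<bar>"
  by (simp add: norm_eq_sqrt_inner inner_circle_point)

lemma power2_dist_eq_inner:
  fixes x y :: "'a::real_inner"
  shows "(dist x y)\<^sup>2 = x \<bullet> x - 2 * (x \<bullet> y) + y \<bullet> y"
  unfolding dist_norm power2_norm_eq_inner by (simp add: inner_diff_left inner_diff_right inner_commute)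

lemma dist_circle_point: "dist (circle_point r a) (circle_point r b) = 2 * \<bar>r\<bar> * \<bar>sin ((a - b) / 2)\<bar>"
proof -
  have "(dist (circle_point r a) (circle_point r b))\<^sup>2 = r * r - 2 * (r * r * cos (a - b)) + r * r"
    by (simp add: power2_dist_eq_inner inner_circle_point)
  also have "cos (a - b) = 1 - 2 * (sin ((a - b) / 2))\<^sup>2"
    using cos_double_sin[of "(a - b) / 2"] by (simp add: del: right_diff_distrib_numeral)
  also have "r * r - 2 * (r * r * \<dots>) + r * r = (2 * \<bar>r\<bar> * \<bar>sin ((a - b) / 2)\<bar>)\<^sup>2"
    unfolding power_mult_distrib power2_abs by (simp add: power2_eq_square algebra_simps)
  finally show ?thesis by (subst (asm) power2_eq_iff_nonneg) auto
qed

lemma circle_point_periodic: "circle_point r (\<theta> + 2 * pi) = circle_point r \<theta>"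
  by (simp add: circle_point_def)

lemma circle_point_eqD:
  assumes "circle_point r a = circle_point r b" "0 < r" "\<bar>a - b\<bar> < 2 * pi"
  shows "a = b"
proof -
  have "r * r * cos (a - b) = r * r"
    using inner_circle_point[of r a r b] inner_circle_point[of r b r b] assms(1) by simp
  then have "cos (a - b) = 1" using assms(2) by simp
  then obtain m :: int where m: "a - b = real_of_int m * 2 * pi" unfolding cos_one_2pi_int by auto
  have "\<bar>real_of_int m\<bar> * (2 * pi) < 1 * (2 * pi)" using assms(3) m by (simp add: abs_mult)
  then have "\<bar>real_of_int m\<bar> < 1" by (simp add: mult_less_cancel_right)
  then have "m = 0" by linarith
  then show ?thesis using m by simp
qed

lemma ex_circle_point_0_2pi:
  obtains \<theta> where "0 \<le> \<theta>" "\<theta> < 2 * pi" "p = circle_point (norm p) \<theta>"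
proof (cases "p = 0")
  case True
  then have "p = circle_point (norm p) 0"
    by (simp add: circle_point_def vec_eq_iff forall_2)
  then show ?thesis using pi_gt_zero by (intro that[of 0]) simp_all
next
  case False
  have norm: "(p $ 1)\<^sup>2 + (p $ 2)\<^sup>2 = (norm p)\<^sup>2"
    unfolding power2_norm_eq_inner by (simp add: inner_vec_def sum_2 power2_eq_square)
  have "(p $ 1 / norm p)\<^sup>2 + (p $ 2 / norm p)\<^sup>2 = 1"
    unfolding power_divide add_divide_distrib[symmetric] norm using False by simp
  then obtain \<theta> where \<theta>: "0 \<le> \<theta>" "\<theta> < 2 * pi" "p $ 1 / norm p = cos \<theta>" "p $ 2 / norm p = sin \<theta>"
    by (rule sincos_total_2pi)
  have "p $ 1 = norm p * cos \<theta>" "p $ 2 = norm p * sin \<theta>"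
    unfolding \<theta>(3,4)[symmetric] using False by simp_all
  then have "p = circle_point (norm p) \<theta>"
    unfolding circle_point_def vec_eq_iff forall_2 by simp
  with \<theta>(1,2) show ?thesis by (rule that)
qed

lemma circle_point_add_int: "circle_point r (\<theta> + of_int m * (2 * pi)) = circle_point r \<theta>"
proof -
  have "cos (\<theta> + of_int m * (2 * pi)) = cos \<theta>" "sin (\<theta> + of_int m * (2 * pi)) = sin \<theta>"
    using cos_int_2pin[of m] sin_int_2pin[of m] by (simp_all add: cos_add sin_add mult.commute mult.left_commute)
  then show ?thesis by (simp add: circle_point_def)
qed

lemma ex_circle_point:
  obtains \<theta> where "a \<le> \<theta>" "\<theta> < a + 2 * pi" "p = circle_point (norm p) \<theta>"
proof -
  obtain \<theta> where t: "p = circle_point (norm p) \<theta>" by (rule ex_circle_point_0_2pi)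
  \<comment> \<open>The number of full turns to remove so that the angle falls into the window
    starting at \<open>a\<close>.\<close>
  define m where "m = \<lfloor>(\<theta> - a) / (2 * pi)\<rfloor>"
  have "of_int m \<le> (\<theta> - a) / (2 * pi)" "(\<theta> - a) / (2 * pi) < of_int m + 1"
    unfolding m_def using floor_correct[of "(\<theta> - a) / (2 * pi)"] by simp_all
  then have "of_int m * (2 * pi) \<le> \<theta> - a" "\<theta> - a < (of_int m + 1) * (2 * pi)"
    by (simp_all add: pos_le_divide_eq pos_divide_less_eq)
  then have "a \<le> \<theta> + of_int (- m) * (2 * pi)" "\<theta> + of_int (- m) * (2 * pi) < a + 2 * pi"
    by (simp_all add: algebra_simps)
  moreover have "p = circle_point (norm p) (\<theta> + of_int (- m) * (2 * pi))"
    unfolding circle_point_add_int by (rule t)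
  ultimately show ?thesis by (rule that)
qed

lemma circle_eq: "0 < t \<Longrightarrow> (\<lambda>x. t *\<^sub>R x) ` sphere (0 :: real ^ 2) 1 = range (circle_point t)"
proof (intro equalityI subsetI)
  fix p assume t: "0 < t" and "p \<in> (\<lambda>x. t *\<^sub>R x) ` sphere (0 :: real ^ 2) 1"
  then have "norm p = t" by auto
  moreover obtain \<theta> where "p = circle_point (norm p) \<theta>" by (rule ex_circle_point_0_2pi)
  ultimately show "p \<in> range (circle_point t)" by (intro range_eqI) simp
next
  fix p assume t: "0 < t" and "p \<in> range (circle_point t)"
  then obtain \<theta> where "p = circle_point t \<theta>" by blast
  then have "p = t *\<^sub>R circle_point 1 \<theta>" by (simp add: circle_point_def vec_eq_iff forall_2)
  then show "p \<in> (\<lambda>x. t *\<^sub>R x) ` sphere (0 :: real ^ 2) 1"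
    by (rule image_eqI) (simp add: norm_circle_point)
qed

text \<open>Here \<open>a\<close> and \<open>b\<close> are the angles from a direction back and
  forward to the ends of its arc, and \<open>c\<close> is the forward angle to a point outside the
  arc. Up to \<open>pi\<close> that point is farther than the forward end; beyond \<open>pi\<close>,
  measured the other way round, it is farther than the backward end.\<close>

lemma cos_less_max:
  assumes "0 \<le> a" "0 \<le> b" "b < c" "c < 2 * pi - a"
  shows "cos c < max (cos a) (cos b)"
proof (cases "c \<le> pi")
  case True
  then have "cos c < cos b" using assms by (intro cos_monotone_0_pi) auto
  then show ?thesis by simp
next
  case False
  then have "cos (2 * pi - c) < cos a" using assms by (intro cos_monotone_0_pi) auto
  then show ?thesis by simp
qed

lemma cos_le_cos:
  assumes "0 \<le> a" "a \<le> c" "c \<le> 2 * pi - a"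
  shows "cos c \<le> cos a"
proof (cases "c \<le> pi")
  case True
  then show ?thesis using assms by (intro cos_monotone_0_pi_le) auto
next
  case False
  then have "cos (2 * pi - c) \<le> cos a" using assms by (intro cos_monotone_0_pi_le) auto
  then show ?thesis by simp
qed

text \<open>For sites of equal norm the squared distances to \<open>p\<close> differ only in the
  inner product term, so the cells are cones at the centre.\<close>

lemma mem_voronoi_cell_iff:
  assumes "\<And>y. y \<in> A \<Longrightarrow> norm y = r" "x \<in> A"
  shows "p \<in> voronoi_cell A x \<longleftrightarrow> (\<forall>y\<in>A. p \<bullet> y \<le> p \<bullet> x)"
proof -
  have sq: "(dist p y)\<^sup>2 = p \<bullet> p - 2 * (p \<bullet> y) + r\<^sup>2" if "y \<in> A" for y
    unfolding power2_dist_eq_inner assms(1)[OF that, symmetric] power2_norm_eq_inner ..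
  have "dist p x \<le> dist p y \<longleftrightarrow> p \<bullet> y \<le> p \<bullet> x" if "y \<in> A" for y
  proof -
    have "dist p x \<le> dist p y \<longleftrightarrow> (dist p x)\<^sup>2 \<le> (dist p y)\<^sup>2" by (simp add: abs_le_square_iff[symmetric])
    then show ?thesis unfolding sq[OF that] sq[OF assms(2)] by simp
  qed
  then show ?thesis by (auto simp: voronoi_cell_def)
qed

text \<open>
  The points of the subset are listed by a sequence of angles that goes around the circle
  forever, so that the starting point can be shifted freely.
\<close>

locale circle_subset =
  fixes t :: real and n :: nat and \<theta> :: "nat \<Rightarrow> real"
  assumes t: "0 < t" and n: "0 < n" and mono: "strict_mono \<theta>"
    and turn: "\<And>j. \<theta> (j + n) = \<theta> j + 2 * pi"
begin

definition point :: "nat \<Rightarrow> real ^ 2" where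
  "point j = circle_point t (\<theta> j)"

definition gap :: "nat \<Rightarrow> real" where
  "gap j = \<theta> (Suc j) - \<theta> j"

section \<open>Cyclic enumeration and gaps\<close>

lemma point_periodic: "point (j + k * n) = point j"
proof (induction k)
  case (Suc k)
  have "point (j + Suc k * n) = point ((j + k * n) + n)" by (simp add: algebra_simps)
  also have "\<dots> = point (j + k * n)" unfolding point_def turn circle_point_periodic ..
  finally show ?case using Suc by simp
qed simp

lemma range_point: "range point = point ` {j..<j + n}"
proof (intro equalityI subsetI)
  fix x assume "x \<in> range point"
  then obtain m where m: "x = point m" by blast
  \<comment> \<open>Adding \<open>j * n\<close> leaves the point unchanged and makes the truncated
    subtraction exact.\<close>
  define d where "d = m + j * n - j"
  have "j \<le> j * n" using n by simp
  then have "m + j * n = j + d" unfolding d_def by linarith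
  then have d: "m + j * n = j + d mod n + (d div n) * n" by simp
  have "x = point (m + j * n)" unfolding m point_periodic ..
  also have "\<dots> = point (j + d mod n)" unfolding d point_periodic ..
  finally show "x \<in> point ` {j..<j + n}" using n by simp
qed auto

lemma gap_pos: "0 < gap j"
  using strict_monoD[OF mono, of j "Suc j"] by (simp add: gap_def)

lemma gap_le: "gap j \<le> 2 * pi"
  using strict_mono_less_eq[OF mono, of "Suc j" "j + n"] turn[of j] n by (simp add: gap_def)

lemma sum_gap: "(\<Sum>j<n. gap j) = 2 * pi"
  unfolding gap_def sum_lessThan_telescope using turn[of 0] by simp

lemma inj_point: "inj_on point {..<n}"
proof (rule inj_onI)
  fix i j assume ij: "i \<in> {..<n}" "j \<in> {..<n}" "point i = point j"
  have "\<bar>\<theta> i - \<theta> j\<bar> < 2 * pi"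
    using ij(1,2) strict_mono_less[OF mono, of i n] strict_mono_less[OF mono, of j n]
      strict_mono_less_eq[OF mono, of 0 i] strict_mono_less_eq[OF mono, of 0 j] turn[of 0] by simp
  then have "\<theta> i = \<theta> j" using circle_point_eqD ij(3) t unfolding point_def by blast
  then show "i = j" using strict_mono_eq[OF mono] by simp
qed

lemma ex_arc:
  assumes "\<theta> 0 \<le> \<psi>" "\<psi> < \<theta> 0 + 2 * pi"
  obtains j where "j < n" "\<theta> j \<le> \<psi>" "\<psi> < \<theta> (Suc j)"
proof -
  define j where "j = Max {j. j < n \<and> \<theta> j \<le> \<psi>}"
  have fin: "finite {j. j < n \<and> \<theta> j \<le> \<psi>}" by simp
  have "{j. j < n \<and> \<theta> j \<le> \<psi>} \<noteq> {}" using n assms(1) by blast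
  from Max_in[OF fin this] have j: "j < n" "\<theta> j \<le> \<psi>" unfolding j_def[symmetric] by simp_all
  have "\<psi> < \<theta> (Suc j)"
  proof (rule ccontr)
    assume a: "\<not> \<psi> < \<theta> (Suc j)"
    then have "Suc j \<noteq> n" using assms(2) turn[of 0] by auto
    then have "Suc j \<in> {j. j < n \<and> \<theta> j \<le> \<psi>}" using a j(1) by simp
    from Max_ge[OF fin this] show False unfolding j_def[symmetric] by simp
  qed
  with j show ?thesis by (rule that)
qed

section \<open>Voronoi cells and the alpha complex of points on a circle\<close>

lemma norm_point: "norm (point j) = t"
  using t by (simp add: point_def norm_circle_point)

lemma voronoi_cell_point:
  "p \<in> voronoi_cell (range point) (point j) \<longleftrightarrow> (\<forall>y\<in>range point. p \<bullet> y \<le> p \<bullet> point j)"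
  by (rule mem_voronoi_cell_iff[where r = t]) (auto simp: norm_point)

definition half_chord :: "nat \<Rightarrow> real" where
  "half_chord j = t * sin (gap j / 2)"

lemma dist_point_Suc: "dist (point j) (point (Suc j)) = 2 * half_chord j"
proof -
  have "0 \<le> sin (gap j / 2)" using gap_pos[of j] gap_le[of j] by (intro sin_ge_zero) auto
  moreover have "\<bar>sin ((\<theta> j - \<theta> (Suc j)) / 2)\<bar> = \<bar>sin (gap j / 2)\<bar>"
    using sin_minus[of "gap j / 2"] by (simp add: gap_def minus_divide_left)
  ultimately show ?thesis using t by (simp add: point_def dist_circle_point half_chord_def)
qed

text \<open>Taking the index in the window of length \<open>n\<close> starting at \<open>j\<close>
  places every point other than \<open>point j\<close> between the end of the \<open>j\<close>-th
  arc and the full turn.\<close>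

lemma range_point_cases:
  assumes "y \<in> range point"
  obtains k where "y = point k" "k \<noteq> j \<Longrightarrow> \<theta> (Suc j) \<le> \<theta> k" "\<theta> k < \<theta> j + 2 * pi"
proof -
  obtain k where k: "y = point k" "j \<le> k" "k < j + n" using assms unfolding range_point[of j] by auto
  have "\<theta> (Suc j) \<le> \<theta> k" if "k \<noteq> j"
    using strict_mono_less_eq[OF mono, of "Suc j" k] k(2) that by simp
  moreover have "\<theta> k < \<theta> j + 2 * pi"
    using strict_mono_less[OF mono, of k "j + n"] turn[of j] k(3) by simp
  ultimately show ?thesis by (rule that[OF k(1)])
qed

text \<open>A common point \<open>p\<close> of the cells and balls is not the centre, whose distance
  from every site is \<open>t\<close>. Its direction lies in some arc, and any site other than the
  two ends of this arc has a strictly smaller inner product with \<open>p\<close> than one of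
  them.\<close>

lemma alpha_simplex_subset_arc:
  assumes "\<epsilon> < t" "\<sigma> \<in> alpha_complex (range point) \<epsilon>"
  obtains j where "j < n" "\<sigma> \<subseteq> {point j, point (Suc j)}"
proof -
  from assms(2) obtain p where sub: "\<sigma> \<subseteq> range point" and ne: "\<sigma> \<noteq> {}"
    and p: "\<And>x. x \<in> \<sigma> \<Longrightarrow> p \<in> cball x \<epsilon> \<inter> voronoi_cell (range point) x"
    unfolding alpha_complex_def nerve_def by blast
  have "p \<noteq> 0"
  proof
    assume "p = 0"
    obtain x where "x \<in> \<sigma>" using ne by blast
    then have "norm x = t" "dist x p \<le> \<epsilon>" using sub p[of x] norm_point by auto
    then show False using \<open>p = 0\<close> assms(1) by simp
  qed
  then have r: "0 < norm p" by simp
  obtain \<psi> where \<psi>: "\<theta> 0 \<le> \<psi>" "\<psi> < \<theta> 0 + 2 * pi" "p = circle_point (norm p) \<psi>"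
    by (rule ex_circle_point)
  obtain j where j: "j < n" "\<theta> j \<le> \<psi>" "\<psi> < \<theta> (Suc j)" using ex_arc[OF \<psi>(1,2)] by blast
  have inner: "p \<bullet> point k = norm p * t * cos (\<theta> k - \<psi>)" for k
  proof -
    have "p \<bullet> point k = circle_point (norm p) \<psi> \<bullet> point k" using \<psi>(3) by simp
    then show ?thesis using cos_minus[of "\<theta> k - \<psi>"] by (simp add: point_def inner_circle_point)
  qed
  have "x \<in> {point j, point (Suc j)}" if x: "x \<in> \<sigma>" for x
  proof (rule ccontr)
    assume nx: "x \<notin> {point j, point (Suc j)}"
    obtain k where k: "x = point k" "k \<noteq> j \<Longrightarrow> \<theta> (Suc j) \<le> \<theta> k" "\<theta> k < \<theta> j + 2 * pi"
      using range_point_cases[of x j] sub x by blast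
    have "k \<noteq> j" "k \<noteq> Suc j" using nx k(1) by auto
    then have "\<theta> (Suc j) < \<theta> k" using k(2) strict_mono_eq[OF mono, of k "Suc j"] by fastforce
    then have "cos (\<theta> k - \<psi>) < max (cos (\<psi> - \<theta> j)) (cos (\<theta> (Suc j) - \<psi>))"
      using j k(3) by (intro cos_less_max) auto
    then have "cos (\<theta> k - \<psi>) < max (cos (\<theta> j - \<psi>)) (cos (\<theta> (Suc j) - \<psi>))"
      using cos_minus[of "\<theta> j - \<psi>"] by simp
    then obtain l where "cos (\<theta> k - \<psi>) < cos (\<theta> l - \<psi>)" by (auto simp: less_max_iff_disj)
    then have "p \<bullet> point k < p \<bullet> point l" using r t by (simp add: inner)
    moreover have "p \<in> voronoi_cell (range point) (point k)" using p[OF x] k(1) by simp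
    ultimately show False unfolding voronoi_cell_point by (meson not_le rangeI)
  qed
  with j(1) that show ?thesis by blast
qed

lemma singleton_mem_alpha_complex:
  assumes "0 \<le> \<epsilon>"
  shows "{point j} \<in> alpha_complex (range point) \<epsilon>"
proof -
  have "point j \<in> (\<Inter>x\<in>{point j}. cball x \<epsilon> \<inter> voronoi_cell (range point) x)"
    using assms by (simp add: voronoi_cell_def)
  then show ?thesis unfolding alpha_complex_def nerve_def by blast
qed

text \<open>The witness is the midpoint of the chord, at radius \<open>t * cos (gap j / 2)\<close>
  in the direction of the middle of the arc. The bound \<open>gap j \<le> pi\<close> makes this
  radius nonnegative, so inner products with the witness are ordered like the cosines.\<close>

lemma edge_mem_alpha_complex:
  assumes "gap j \<le> pi" "half_chord j \<le> \<epsilon>"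
  shows "{point j, point (Suc j)} \<in> alpha_complex (range point) \<epsilon>"
proof -
  define \<mu> where "\<mu> = (\<theta> j + \<theta> (Suc j)) / 2"
  define c where "c = cos (gap j / 2)"
  define p where "p = circle_point (t * c) \<mu>"
  have c: "0 \<le> c" unfolding c_def using gap_pos[of j] assms(1) by (intro cos_ge_zero) auto
  have inner: "p \<bullet> point k = t * c * t * cos (\<theta> k - \<mu>)" for k
    using cos_minus[of "\<theta> k - \<mu>"] by (simp add: p_def point_def inner_circle_point)
  have "\<theta> j - \<mu> = - (gap j / 2)" "\<theta> (Suc j) - \<mu> = gap j / 2" by (simp_all add: \<mu>_def gap_def field_simps)
  then have cos: "cos (\<theta> k - \<mu>) = c" if "k = j \<or> k = Suc j" for k
    using that cos_minus[of "gap j / 2"] unfolding c_def by (elim disjE) (simp_all only:)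
  have "p \<in> cball (point k) \<epsilon> \<inter> voronoi_cell (range point) (point k)" if k: "k = j \<or> k = Suc j" for k
  proof
    have "(dist p (point k))\<^sup>2 = p \<bullet> p - 2 * (p \<bullet> point k) + point k \<bullet> point k"
      by (rule power2_dist_eq_inner)
    also have "\<dots> = t\<^sup>2 * (1 - c\<^sup>2)"
      unfolding inner cos[OF k]
      by (simp add: p_def point_def inner_circle_point power2_eq_square algebra_simps)
    also have "\<dots> = (half_chord j)\<^sup>2"
      unfolding half_chord_def c_def power_mult_distrib sin_squared_eq ..
    finally have "(dist p (point k))\<^sup>2 = (half_chord j)\<^sup>2" .
    moreover have "0 \<le> half_chord j" using dist_point_Suc[of j] zero_le_dist[of "point j" "point (Suc j)"] by linarith
    ultimately have "dist p (point k) = half_chord j" by (subst (asm) power2_eq_iff_nonneg) auto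
    then show "p \<in> cball (point k) \<epsilon>" using assms(2) by (simp add: dist_commute)
  next
    show "p \<in> voronoi_cell (range point) (point k)"
      unfolding voronoi_cell_point
    proof
      fix y assume "y \<in> range point"
      then obtain l where l: "y = point l" "l \<noteq> j \<Longrightarrow> \<theta> (Suc j) \<le> \<theta> l" "\<theta> l < \<theta> j + 2 * pi"
        using range_point_cases[of y j] by blast
      have "cos (\<theta> l - \<mu>) \<le> c"
      proof (cases "l = j")
        case True
        then show ?thesis using cos[of l] by simp
      next
        case False
        then show ?thesis unfolding c_def using l(2,3) gap_pos[of j]
          by (intro cos_le_cos) (simp_all add: \<mu>_def gap_def field_simps)
      qed
      then show "p \<bullet> y \<le> p \<bullet> point k"
        unfolding l(1) inner cos[OF k] using t c by (intro mult_left_mono) auto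
    qed
  qed
  then have "p \<in> (\<Inter>x\<in>{point j, point (Suc j)}. cball x \<epsilon> \<inter> voronoi_cell (range point) x)" by blast
  then show ?thesis unfolding alpha_complex_def nerve_def by blast
qed

lemma alpha_complex_above:
  assumes "t \<le> \<epsilon>"
  shows "alpha_complex (range point) \<epsilon> = {\<sigma>. \<sigma> \<subseteq> range point \<and> \<sigma> \<noteq> {}}"
proof -
  have "0 \<in> cball x \<epsilon> \<inter> voronoi_cell (range point) x" if x: "x \<in> range point" for x
    using x assms norm_point by (auto simp: voronoi_cell_def)
  then have "0 \<in> (\<Inter>x\<in>\<sigma>. cball x \<epsilon> \<inter> voronoi_cell (range point) x)" if s: "\<sigma> \<subseteq> range point" for \<sigma>
    using s by blast
  then have "(\<Inter>x\<in>\<sigma>. cball x \<epsilon> \<inter> voronoi_cell (range point) x) \<noteq> {}" if s: "\<sigma> \<subseteq> range point" for \<sigma>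
    using s by blast
  moreover have "finite (range point)" unfolding range_point[of 0] by simp
  ultimately show ?thesis
    unfolding alpha_complex_def nerve_def by (auto intro: finite_subset)
qed

lemma alpha_complex_below:
  assumes "0 \<le> \<epsilon>" "\<epsilon> < t" and gap: "\<And>j. j < n \<Longrightarrow> gap j \<le> pi"
  shows "alpha_complex (range point) \<epsilon>
    = {{point j} |j. j < n} \<union> {{point j, point (Suc j)} |j. j < n \<and> half_chord j \<le> \<epsilon>}"
proof (intro equalityI subsetI)
  fix \<sigma> assume s: "\<sigma> \<in> alpha_complex (range point) \<epsilon>"
  then obtain j where j: "j < n" "\<sigma> \<subseteq> {point j, point (Suc j)}"
    using alpha_simplex_subset_arc[OF assms(2)] by blast
  from s have ne: "\<sigma> \<noteq> {}" and "(\<Inter>x\<in>\<sigma>. cball x \<epsilon> \<inter> voronoi_cell (range point) x) \<noteq> {}"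
    unfolding alpha_complex_def nerve_def by simp_all
  then obtain p where "p \<in> (\<Inter>x\<in>\<sigma>. cball x \<epsilon> \<inter> voronoi_cell (range point) x)" by blast
  then have p: "dist x p \<le> \<epsilon>" if "x \<in> \<sigma>" for x using that by simp
  from ne consider "\<sigma> = {point j}" | "\<sigma> = {point (Suc j)}" | "\<sigma> = {point j, point (Suc j)}"
    using j(2) by blast
  then show "\<sigma> \<in> {{point j} |j. j < n} \<union> {{point j, point (Suc j)} |j. j < n \<and> half_chord j \<le> \<epsilon>}"
  proof cases
    case 1 then show ?thesis using j(1) by blast
  next
    case 2
    \<comment> \<open>\<open>Suc j\<close> may equal \<open>n\<close>, so the index has to be
      wrapped around.\<close>
    have "point (Suc j) \<in> point ` {..<n}"
      using range_point[of 0] by (metis atLeast0LessThan add_0 rangeI)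
    then show ?thesis using 2 by blast
  next
    case 3
    \<comment> \<open>A witness within \<epsilon> of both ends forces the chord to have length at
      most \<open>2 * \<epsilon>\<close>.\<close>
    have "2 * half_chord j \<le> dist (point j) p + dist (point (Suc j)) p"
      unfolding dist_point_Suc[symmetric] by (rule dist_triangle2)
    also have "\<dots> \<le> 2 * \<epsilon>" using p[of "point j"] p[of "point (Suc j)"] 3 by simp
    finally show ?thesis using 3 j(1) by auto
  qed
next
  fix \<sigma> assume "\<sigma> \<in> {{point j} |j. j < n} \<union> {{point j, point (Suc j)} |j. j < n \<and> half_chord j \<le> \<epsilon>}"
  then show "\<sigma> \<in> alpha_complex (range point) \<epsilon>"
    using singleton_mem_alpha_complex[OF assms(1)] edge_mem_alpha_complex[OF gap] by blast
qed

lemma alpha_magnitude_points: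
  assumes gap: "\<And>j. j < n \<Longrightarrow> gap j < pi" and last: "\<And>j. j < n \<Longrightarrow> gap j \<le> gap (n - 1)"
  shows "alpha_magnitude TYPE('k::field) (range point) = (\<Sum>j<n. 1 - exp (- half_chord j)) + exp (- t)"
proof -
  \<comment> \<open>The gaps add up to \<open>2 * pi\<close> and each is below \<open>pi\<close>, so
    two of them are not enough.\<close>
  have "3 \<le> n"
  proof (rule ccontr)
    assume "\<not> 3 \<le> n"
    then have "n = 1 \<or> n = 2" using n by auto
    then show False using sum_gap gap[of 0] gap[of 1] by (auto simp: numeral_2_eq_2)
  qed
  have "cycle_filtration n point half_chord t (alpha_complex (range point))"
  proof
    show "3 \<le> n" by fact
    show "inj_on point {..<n}" by (rule inj_point)
    show "point n = point 0" using point_periodic[of 0 1] by simp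
    fix j assume j: "j < n"
    show "0 < half_chord j"
      unfolding half_chord_def using gap_pos[of j] gap[OF j] t by (intro mult_pos_pos sin_gt_zero) auto
    \<comment> \<open>Half gaps stay below \<open>pi / 2\<close>, where the sine increases, so the
      longest gap has the longest chord.\<close>
    show "half_chord j \<le> half_chord (n - 1)"
      unfolding half_chord_def using gap_pos[of j] gap[of "n - 1"] last[OF j] t n
      by (intro mult_left_mono sin_monotone_2pi_le) auto
    have "sin (gap j / 2) < sin (pi / 2)" using gap_pos[of j] gap[OF j] by (intro sin_monotone_2pi) auto
    then show "half_chord j < t" unfolding half_chord_def using t by simp
  next
    fix \<epsilon> :: real assume "0 \<le> \<epsilon>" "\<epsilon> < t"
    then show "alpha_complex (range point) \<epsilon>
      = {{point j} |j. j < n} \<union> {{point j, point (Suc j)} |j. j < n \<and> half_chord j \<le> \<epsilon>}"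
      using gap by (intro alpha_complex_below) (auto intro: less_imp_le)
  next
    fix \<epsilon> :: real assume "t \<le> \<epsilon>"
    then show "alpha_complex (range point) \<epsilon> = {\<sigma>. \<sigma> \<subseteq> point ` {..<n} \<and> \<sigma> \<noteq> {}}"
      using alpha_complex_above range_point[of 0] by (simp add: atLeast0LessThan)
  qed
  from cycle_filtration.has_persistent_magnitude[OF this] show ?thesis
    unfolding alpha_magnitude_def by (rule persistent_magnitude_eqI)
qed

text \<open>The middle of an arc of length at least \<eta> is at angle at least
  \<open>\<eta> / 2\<close> from every site, and \<open>2 * t * sin (\<eta> / 4)\<close> is the
  chord of that angle.\<close>

lemma gap_less:
  assumes "0 < \<eta>" "\<eta> < pi"
    and dense: "\<And>x. x \<in> range (circle_point t) \<Longrightarrow> \<exists>a\<in>range point. dist x a < 2 * t * sin (\<eta> / 4)"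
  shows "gap j < \<eta>"
proof (rule ccontr)
  assume a: "\<not> gap j < \<eta>"
  define \<mu> where "\<mu> = (\<theta> j + \<theta> (Suc j)) / 2"
  obtain y where y: "y \<in> range point" "dist (circle_point t \<mu>) y < 2 * t * sin (\<eta> / 4)"
    using dense[of "circle_point t \<mu>"] by blast
  from y(1) obtain k where k: "y = point k" "k \<noteq> j \<Longrightarrow> \<theta> (Suc j) \<le> \<theta> k" "\<theta> k < \<theta> j + 2 * pi"
    using range_point_cases[of y j] by blast
  \<comment> \<open>Half the angular difference from the middle of the arc. The upper bound on
    \<open>d\<close> says that the site is not close the other way round either.\<close>
  define d where "d = \<bar>\<mu> - \<theta> k\<bar> / 2"
  have d: "\<eta> / 4 \<le> d" "d \<le> pi - \<eta> / 4"
    using k(2,3) gap_le[of j] assms(1,2) a by (cases "k = j"; simp add: d_def \<mu>_def gap_def abs_if field_simps)+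
  have "sin (\<eta> / 4) \<le> sin d"
  proof (cases "d \<le> pi / 2")
    case True
    then show ?thesis using d assms by (intro sin_monotone_2pi_le) auto
  next
    case False
    then have "sin (\<eta> / 4) \<le> sin (pi - d)" using d assms by (intro sin_monotone_2pi_le) auto
    then show ?thesis by simp
  qed
  also have "\<dots> \<le> \<bar>sin ((\<mu> - \<theta> k) / 2)\<bar>"
    using sin_minus[of "(\<mu> - \<theta> k) / 2"] by (simp add: d_def abs_if minus_divide_left)
  finally have "2 * t * sin (\<eta> / 4) \<le> dist (circle_point t \<mu>) y"
    using t by (simp add: k(1) point_def dist_circle_point)
  with y(2) show False by simp
qed

end

text \<open>The angles in \<open>[0, 2 * pi)\<close> are sorted, continued periodically to all
  indices, and then shifted to bring a maximal gap to index \<open>n - 1\<close>.\<close>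

lemma ex_circle_subset:
  assumes t: "0 < t" and A: "finite A" "A \<noteq> {}" "A \<subseteq> range (circle_point t)"
  obtains n \<theta> where "circle_subset t n \<theta>" "A = range (circle_subset.point t \<theta>)"
    "\<And>j. circle_subset.gap \<theta> j \<le> circle_subset.gap \<theta> (n - 1)"
proof -
  define \<Theta> where "\<Theta> = {\<theta>. 0 \<le> \<theta> \<and> \<theta> < 2 * pi \<and> circle_point t \<theta> \<in> A}"
  have "inj_on (circle_point t) \<Theta>"
    by (rule inj_onI, rule circle_point_eqD) (use t in \<open>auto simp: \<Theta>_def\<close>)
  moreover have "circle_point t ` \<Theta> \<subseteq> A" by (auto simp: \<Theta>_def)
  ultimately have fin: "finite \<Theta>" using A(1) by (meson finite_imageD finite_subset)
  have A_eq: "A = circle_point t ` \<Theta>"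
  proof
    show "A \<subseteq> circle_point t ` \<Theta>"
    proof
      fix x assume x: "x \<in> A"
      then have "norm x = t" using A(3) t by (auto simp: norm_circle_point)
      moreover obtain \<theta> where "0 \<le> \<theta>" "\<theta> < 2 * pi" "x = circle_point (norm x) \<theta>"
        by (rule ex_circle_point_0_2pi)
      ultimately have "x = circle_point t \<theta>" "\<theta> \<in> \<Theta>" using x by (simp_all add: \<Theta>_def)
      then show "x \<in> circle_point t ` \<Theta>" by (rule image_eqI)
    qed
  qed fact
  define xs where "xs = sorted_list_of_set \<Theta>"
  define n where "n = length xs"
  have set: "set xs = \<Theta>" using fin by (simp add: xs_def)
  have n: "0 < n" using A(2) A_eq set by (auto simp: n_def)
  have less: "xs ! i < xs ! j" if "i < j" "j < n" for i j
    using that sorted_wrt_nth_less[OF strict_sorted_list_of_set[of \<Theta>], of i j] by (simp add: xs_def n_def)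
  have range: "0 \<le> xs ! i \<and> xs ! i < 2 * pi" if "i < n" for i
    using nth_mem[of i xs] that unfolding set by (simp add: n_def \<Theta>_def)
  \<comment> \<open>The remainder selects the point and the quotient counts the completed
    turns.\<close>
  define \<phi> where "\<phi> j = xs ! (j mod n) + 2 * pi * real (j div n)" for j
  have turn: "\<phi> (j + n) = \<phi> j + 2 * pi" for j
    using n by (simp add: \<phi>_def algebra_simps)
  have mono: "strict_mono \<phi>"
    unfolding strict_mono_Suc_iff
  proof
    fix j
    show "\<phi> j < \<phi> (Suc j)"
    proof (cases "Suc (j mod n) = n")
      case True
      then have "Suc j mod n = 0" "Suc j div n = Suc (j div n)" by (simp_all add: mod_Suc div_Suc)
      then show ?thesis using range[of "j mod n"] range[of 0] n by (simp add: \<phi>_def algebra_simps)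
    next
      case False
      then have s: "Suc j mod n = Suc (j mod n)" "Suc j div n = j div n" by (simp_all add: mod_Suc div_Suc)
      have "Suc (j mod n) < n" using False mod_less_divisor[OF n, of j] by linarith
      then show ?thesis using less[of "j mod n" "Suc (j mod n)"] by (simp add: \<phi>_def s)
    qed
  qed
  have sub: "circle_subset t n \<phi>" by unfold_locales (use t n mono turn in auto)
  have "circle_subset.point t \<phi> j = circle_point t (xs ! j)" if "j < n" for j
    using that by (simp add: circle_subset.point_def[OF sub] \<phi>_def)
  then have "range (circle_subset.point t \<phi>) = (\<lambda>j. circle_point t (xs ! j)) ` {0..<n}"
    unfolding circle_subset.range_point[OF sub, of 0] by (intro image_cong) auto
  also have "\<dots> = circle_point t ` set xs"
  proof -
    have "set xs = (!) xs ` {0..<n}" by (auto simp: n_def set_conv_nth)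
    then show ?thesis by (simp add: image_image)
  qed
  also have "\<dots> = A" unfolding set A_eq ..
  finally have A_range: "A = range (circle_subset.point t \<phi>)" ..
  define g where "g j = \<phi> (Suc j) - \<phi> j" for j
  have g_periodic: "g (j + k * n) = g j" for j k
  proof (induction k)
    case (Suc k)
    have "g (j + Suc k * n) = g ((j + k * n) + n)" by (simp add: algebra_simps)
    also have "\<dots> = g (j + k * n)" using turn[of "Suc (j + k * n)"] turn[of "j + k * n"] by (simp add: g_def)
    finally show ?case using Suc by simp
  qed simp
  have "Max (g ` {..<n}) \<in> g ` {..<n}" using n by (intro Max_in) auto
  then obtain m where m: "m < n" "g m = Max (g ` {..<n})" by auto
  have g_max: "g j \<le> g m" for j
  proof -
    have "g j = g (j mod n)" using g_periodic[of "j mod n" "j div n"] by simp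
    also have "\<dots> \<le> g m" unfolding m(2) using n by (intro Max_ge) auto
    finally show ?thesis .
  qed
  \<comment> \<open>After a shift by \<open>Suc m\<close>, index \<open>n - 1\<close> becomes
    \<open>m + n\<close>, whose gap is the maximal one at \<open>m\<close>.\<close>
  define \<theta> where "\<theta> j = \<phi> (j + Suc m)" for j
  have sub': "circle_subset t n \<theta>"
  proof
    show "strict_mono \<theta>" unfolding \<theta>_def strict_mono_def using strict_monoD[OF mono] by simp
    show "\<theta> (j + n) = \<theta> j + 2 * pi" for j using turn[of "j + Suc m"] by (simp add: \<theta>_def algebra_simps)
  qed (use t n in auto)
  have "range (circle_subset.point t \<theta>) = circle_subset.point t \<phi> ` {Suc m..<Suc m + n}"
  proof -
    have shift: "{Suc m..<Suc m + n} = (\<lambda>j. j + Suc m) ` {0..<0 + n}"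
      unfolding image_add_atLeastLessThan' by (simp add: add.commute)
    have "circle_subset.point t \<theta> j = circle_subset.point t \<phi> (j + Suc m)" for j
      by (simp only: circle_subset.point_def[OF sub] circle_subset.point_def[OF sub'] \<theta>_def)
    then show ?thesis
      unfolding circle_subset.range_point[OF sub', of 0] shift image_image by (intro image_cong refl)
  qed
  then have "range (circle_subset.point t \<theta>) = A"
    unfolding circle_subset.range_point[OF sub, symmetric] A_range .
  moreover have "circle_subset.gap \<theta> j \<le> circle_subset.gap \<theta> (n - 1)" for j
  proof -
    have "circle_subset.gap \<theta> j = g (j + Suc m)" for j
      by (simp add: circle_subset.gap_def[OF sub'] \<theta>_def g_def)
    moreover have "g (n - 1 + Suc m) = g m" using g_periodic[of m 1] n by (simp add: add.commute)
    ultimately show ?thesis using g_max by simp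
  qed
  ultimately show ?thesis using that[OF sub'] by blast
qed


section \<open>The limit\<close>

text \<open>Two errors of second order add up: replacing \<open>1 - exp (- s)\<close> by
  \<open>s = t * sin u\<close> costs at most \<open>(t * u)\<^sup>2\<close>, and replacing
  \<open>t * sin u\<close> by \<open>t * u\<close> costs at most
  \<open>t * u\<^sup>2\<close>.\<close>

lemma abs_one_minus_exp_sin_le:
  fixes t u :: real
  assumes "0 \<le> t" "0 \<le> u" "u \<le> pi"
  shows "\<bar>(1 - exp (- (t * sin u))) - t * u\<bar> \<le> (t\<^sup>2 + t) * u\<^sup>2"
proof -
  define s where "s = t * sin u"
  have "0 \<le> sin u" using assms by (intro sin_ge_zero)
  moreover have sin_le: "sin u \<le> u" using assms(2) by (rule sin_x_le_x)
  ultimately have s: "0 \<le> s" "s \<le> t * u" using assms by (auto simp: s_def mult_left_mono)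
  have "\<bar>sin u - u\<bar> \<le> u\<^sup>2 / 2"
    using Maclaurin_sin_bound[of u 2] by (simp add: numeral_2_eq_2 sin_coeff_def power2_eq_square)
  then have "u - sin u \<le> u\<^sup>2" using zero_le_power2[of u] by linarith
  then have "t * (u - sin u) \<le> t * u\<^sup>2" using assms(1) by (rule mult_left_mono)
  then have s_ge: "t * u - s \<le> t * u\<^sup>2" by (simp add: s_def algebra_simps)
  have "1 - s \<le> exp (- s)" using exp_ge_add_one_self[of "- s"] by simp
  then have upper: "1 - exp (- s) \<le> t * u" using s by simp
  have "exp (- s) * (1 + s) \<le> exp (- s) * exp s" using exp_ge_add_one_self[of s] by (intro mult_left_mono) auto
  then have "exp (- s) * (1 + s) \<le> 1" by (simp add: exp_minus)
  \<comment> \<open>The product is \<open>1 + s ^ 3\<close>. Cancelling \<open>1 + s\<close> turns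
    the bound into the second-order estimate of the exponential.\<close>
  also have "1 \<le> (1 - s + s\<^sup>2) * (1 + s)"
    using s(1) by (simp add: algebra_simps power2_eq_square)
  finally have "exp (- s) \<le> 1 - s + s\<^sup>2" using s(1) by (simp add: mult_le_cancel_right)
  moreover have "s\<^sup>2 \<le> (t * u)\<^sup>2" using s by (intro power_mono)
  ultimately have "t * u - (1 - exp (- s)) \<le> t * u\<^sup>2 + t\<^sup>2 * u\<^sup>2"
    using s_ge by (simp add: power_mult_distrib)
  then show ?thesis using upper unfolding s_def[symmetric] by (simp add: abs_if algebra_simps)
qed

text \<open>In each squared gap one factor is bounded through \<eta>, while the other factors sum to
  \<open>2 * pi\<close>, so the bound does not involve the number of points.\<close>

lemma alpha_magnitude_dense_bound:
  assumes t: "0 < t" and \<eta>: "0 < \<eta>" "\<eta> < pi"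
    and A: "finite A" "A \<subseteq> range (circle_point t)"
    and dense: "\<And>x. x \<in> range (circle_point t) \<Longrightarrow> \<exists>a\<in>A. dist x a < 2 * t * sin (\<eta> / 4)"
  shows "\<bar>alpha_magnitude TYPE('k::field) A - (pi * t + exp (- t))\<bar> \<le> (t\<^sup>2 + t) * pi * \<eta>"
proof -
  have "A \<noteq> {}" using dense by blast
  then obtain n \<theta> where sub: "circle_subset t n \<theta>" and A_eq: "A = range (circle_subset.point t \<theta>)"
    and last: "\<And>j. circle_subset.gap \<theta> j \<le> circle_subset.gap \<theta> (n - 1)"
    using ex_circle_subset[OF t A(1) _ A(2)] by blast
  interpret circle_subset t n \<theta> by (rule sub)
  have gap: "gap j < \<eta>" for j using \<eta> dense unfolding A_eq by (rule gap_less)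
  have "alpha_magnitude TYPE('k) A = (\<Sum>j<n. 1 - exp (- half_chord j)) + exp (- t)"
    unfolding A_eq using gap \<eta>(2) last by (intro alpha_magnitude_points) (auto intro: less_trans)
  moreover have "pi * t = (\<Sum>j<n. t * (gap j / 2))"
    using sum_gap by (simp add: sum_distrib_left[symmetric] sum_divide_distrib[symmetric])
  ultimately have "alpha_magnitude TYPE('k) A - (pi * t + exp (- t))
      = (\<Sum>j<n. (1 - exp (- half_chord j)) - t * (gap j / 2))"
    by (simp add: sum_subtractf)
  also have "\<bar>\<dots>\<bar> \<le> (\<Sum>j<n. \<bar>(1 - exp (- half_chord j)) - t * (gap j / 2)\<bar>)" by (rule sum_abs)
  also have "\<dots> \<le> (\<Sum>j<n. (t\<^sup>2 + t) * (\<eta> / 2) * gap j)"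
  proof (rule sum_mono)
    fix j
    have "\<bar>(1 - exp (- half_chord j)) - t * (gap j / 2)\<bar> \<le> (t\<^sup>2 + t) * (gap j / 2)\<^sup>2"
      unfolding half_chord_def using t gap_pos[of j] gap_le[of j] by (intro abs_one_minus_exp_sin_le) auto
    also have "(gap j / 2)\<^sup>2 = (gap j / 4) * gap j" by (simp add: power2_eq_square)
    also have "(t\<^sup>2 + t) * \<dots> \<le> (t\<^sup>2 + t) * ((\<eta> / 2) * gap j)"
      using t gap[of j] gap_pos[of j] \<eta>(1) by (intro mult_left_mono mult_right_mono) auto
    finally show "\<bar>(1 - exp (- half_chord j)) - t * (gap j / 2)\<bar> \<le> (t\<^sup>2 + t) * (\<eta> / 2) * gap j"
      by (simp add: mult.assoc)
  qed
  also have "\<dots> = (t\<^sup>2 + t) * pi * \<eta>"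
    unfolding sum_distrib_left[symmetric] sum_gap by simp
  finally show ?thesis .
qed

text \<open>The infimum over the empty set is infinite, so a finite bound also forces
  \<open>A\<close> to be nonempty once \<open>B\<close> has an element.\<close>

lemma hausdorff_distance_lessD:
  assumes "hausdorff_distance A B < ennreal \<delta>" "b \<in> B"
  shows "\<exists>a\<in>A. dist b a < \<delta>"
proof -
  have "(INF a\<in>A. ennreal (dist a b)) \<le> hausdorff_distance A B"
    unfolding hausdorff_distance_def using assms(2) by (intro max.coboundedI2 SUP_upper)
  then have "(INF a\<in>A. ennreal (dist a b)) < ennreal \<delta>" using assms(1) by (rule le_less_trans)
  then obtain a where "a \<in> A" "ennreal (dist a b) < ennreal \<delta>" by (auto simp: INF_less_iff)
  then show ?thesis by (auto simp: ennreal_less_iff dist_commute)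
qed

theorem proposition3p15:
  fixes t :: real
  assumes "0 < t"
  shows "has_alpha_magnitude TYPE('k::field)
           ((\<lambda>x. t *\<^sub>R x) ` sphere (0 :: real ^ 2) 1) (pi * t + exp (- t))"
  unfolding has_alpha_magnitude_def
proof (intro conjI allI impI)
  show "compact ((\<lambda>x. t *\<^sub>R x) ` sphere (0 :: real ^ 2) 1)"
    by (intro compact_scaling compact_sphere)
next
  fix A :: "nat \<Rightarrow> (real ^ 2) set"
  assume A: "(\<forall>m. finite (A m) \<and> A m \<subseteq> (\<lambda>x. t *\<^sub>R x) ` sphere 0 1) \<and>
      (\<lambda>m. hausdorff_distance (A m) ((\<lambda>x. t *\<^sub>R x) ` sphere 0 1)) \<longlonglongrightarrow> 0"
  show "(\<lambda>m. alpha_magnitude TYPE('k) (A m)) \<longlonglongrightarrow> pi * t + exp (- t)"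
  proof (rule tendstoI)
    fix e :: real assume e: "0 < e"
    define C where "C = (t\<^sup>2 + t) * pi"
    have C: "0 < C" using assms by (simp add: C_def add_pos_pos)
    \<comment> \<open>The first entry keeps the gaps below \<open>pi\<close>; the second makes the
      error bound \<open>C * \<eta>\<close> at most \<open>e / 2\<close>.\<close>
    define \<eta> where "\<eta> = min (pi / 2) (e / (2 * C))"
    have \<eta>: "0 < \<eta>" "\<eta> < pi" using e C pi_gt_zero by (auto simp: \<eta>_def min_less_iff_disj)
    have "C * \<eta> \<le> C * (e / (2 * C))" using C by (intro mult_left_mono) (auto simp: \<eta>_def)
    then have C\<eta>: "C * \<eta> < e" using C e by simp
    have "0 < 2 * t * sin (\<eta> / 4)" using assms \<eta> by (intro mult_pos_pos sin_gt_zero) auto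
    then have "\<forall>\<^sub>F m in sequentially. hausdorff_distance (A m) ((\<lambda>x. t *\<^sub>R x) ` sphere 0 1) < ennreal (2 * t * sin (\<eta> / 4))"
      using A by (intro order_tendstoD(2)[of _ 0]) auto
    then show "\<forall>\<^sub>F m in sequentially. dist (alpha_magnitude TYPE('k) (A m)) (pi * t + exp (- t)) < e"
    proof (rule eventually_mono)
      fix m assume "hausdorff_distance (A m) ((\<lambda>x. t *\<^sub>R x) ` sphere 0 1) < ennreal (2 * t * sin (\<eta> / 4))"
      then have "\<exists>a\<in>A m. dist x a < 2 * t * sin (\<eta> / 4)" if "x \<in> range (circle_point t)" for x
        using that unfolding circle_eq[OF assms] by (rule hausdorff_distance_lessD)
      then have "\<bar>alpha_magnitude TYPE('k) (A m) - (pi * t + exp (- t))\<bar> \<le> C * \<eta>"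
        unfolding C_def using A \<eta> assms circle_eq[OF assms] by (intro alpha_magnitude_dense_bound) auto
      then show "dist (alpha_magnitude TYPE('k) (A m)) (pi * t + exp (- t)) < e"
        using C\<eta> by (simp add: dist_real_def)
    qed
  qed
qed

end
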